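(* Let $X,Y$ be complex Banach spaces and $f\in\mathcal{H}L_0(B_X,Y)$. The following statements are equivalent: (i) $f:B_X\to Y$ is compact holomorphic Lipschitz. (ii) $f^t:Y^*\to\mathcal{H}L_0(B_X)$ is compact. (iii) $f^t:Y^*\to\mathcal{H}L_0(B_X)$ is bounded-weak*-to-norm continuous. (iv) $f^t:Y^*\to\mathcal{H}L_0(B_X)$ is compact and bounded-weak*-to-weak continuous. (v) $f^t:Y^*\to\mathcal{H}L_0(B_X)$ is compact and weak*-to-weak continuous.
   Context: $B_X$ is the open unit ball of $X$. $\mathcal{H}L_0(B_X,Y)$ is the Banach space of all holomorphic Lipschitz maps $f:B_X\to Y$ with $f(0)=0$, with norm $L(f)=\sup\{\|f(x)-f(y)\|/\|x-y\|: x,y\in B_X,\ x\ne y\}$; $\mathcal{H}L_0(B_X)=\mathcal{H}L_0(B_X,\mathbb{C})$. A map $f\in\mathcal{H}L_0(B_X,Y)$ is compact holomorphic Lipschitz if its Lipschitz image $\mathrm{Im}_L(f)=\{(f(x)-f(y))/\|x-y\|:x,y\in B_X,\ x\neq y\}$ is relatively compact in $Y$. The transpose $f^t\in\mathcal{L}(Y^*,\mathcal{H}L_0(B_X))$ is $f^t(y^* )=y^*\circ f$. The bounded weak* topology on $Y^*$ is the finest topology agreeing with the weak* topology on every norm-bounded subset. The weak topology on $\mathcal{H}L_0(B_X)$ is that of the Banach space $(\mathcal{H}L_0(B_X),L)$. *)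

theory Defs
  imports "HOL-Analysis.Analysis"
begin

section \<open>Complex normed spaces\<close>

text \<open>
  The distribution has type classes for real normed spaces only.  A complex normed space is a
  real one together with a complex scalar multiplication that extends the real one and for
  which the norm is homogeneous.  A complex Banach space is a type of sort
  \<open>{complex_normed_vector, banach}\<close>.
\<close>

class complex_normed_vector = real_normed_vector +
  fixes scaleC :: "complex \<Rightarrow> 'a \<Rightarrow> 'a" (infixr \<open>*\<^sub>C\<close> 75)
  assumes scaleC_add_right: "c *\<^sub>C (x + y) = c *\<^sub>C x + c *\<^sub>C y"
    and scaleC_add_left: "(c + d) *\<^sub>C x = c *\<^sub>C x + d *\<^sub>C x"
    and scaleC_scaleC: "c *\<^sub>C d *\<^sub>C x = (c * d) *\<^sub>C x"
    and scaleR_scaleC: "scaleR r x = complex_of_real r *\<^sub>C x"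
    and norm_scaleC: "norm (c *\<^sub>C x) = cmod c * norm x"

instantiation complex :: complex_normed_vector
begin

definition scaleC_complex :: "complex \<Rightarrow> complex \<Rightarrow> complex"
  where "scaleC_complex c z = c * z"

instance
  by standard (auto simp: scaleC_complex_def algebra_simps norm_mult scaleR_conv_of_real)

end

lemma scaleC_diff_right: "c *\<^sub>C (x - y) = c *\<^sub>C x - c *\<^sub>C (y::'a::complex_normed_vector)"
  by (metis add_diff_cancel diff_add_cancel scaleC_add_right)

lemma scaleC_zero_right [simp]: "c *\<^sub>C (0::'a::complex_normed_vector) = 0"
  using scaleC_diff_right[of c 0 0] by simp

lemma scaleC_one: "1 *\<^sub>C (x::'a::complex_normed_vector) = x"
  using scaleR_scaleC[of 1 x] by simp

lemma bounded_linear_scaleC: "bounded_linear (\<lambda>x::'a::complex_normed_vector. c *\<^sub>C x)"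
proof (rule bounded_linear_intro)
  show "c *\<^sub>C (r *\<^sub>R x) = r *\<^sub>R (c *\<^sub>C x)" for r and x :: 'a
    by (simp add: scaleR_scaleC scaleC_scaleC mult.commute)
  show "norm (c *\<^sub>C x) \<le> norm x * cmod c" for x :: 'a
    by (simp add: norm_scaleC)
qed (rule scaleC_add_right)

definition bounded_clinear :: "('a::complex_normed_vector \<Rightarrow> 'b::complex_normed_vector) \<Rightarrow> bool"
  where "bounded_clinear T \<longleftrightarrow> bounded_linear T \<and> (\<forall>c x. T (c *\<^sub>C x) = c *\<^sub>C T x)"

lemma bounded_clinear_bounded_linear: "bounded_clinear T \<Longrightarrow> bounded_linear T"
  by (simp add: bounded_clinear_def)

lemma bounded_clinear_zero: "bounded_clinear (\<lambda>_. 0)"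
  by (simp add: bounded_clinear_def bounded_linear_zero)

lemma bounded_clinear_add:
  "bounded_clinear S \<Longrightarrow> bounded_clinear T \<Longrightarrow> bounded_clinear (\<lambda>x. S x + T x)"
  by (simp add: bounded_clinear_def bounded_linear_add scaleC_add_right)

lemma bounded_clinear_scaleC: "bounded_clinear T \<Longrightarrow> bounded_clinear (\<lambda>x. c *\<^sub>C T x)"
  unfolding bounded_clinear_def
  using bounded_linear_compose[OF bounded_linear_scaleC[of c], of T]
  by (simp add: scaleC_scaleC mult.commute)

lemma bounded_clinear_scaleR: "bounded_clinear T \<Longrightarrow> bounded_clinear (\<lambda>x. r *\<^sub>R T x)"
  by (simp add: scaleR_scaleC bounded_clinear_scaleC)

lemma bounded_clinear_uminus: "bounded_clinear T \<Longrightarrow> bounded_clinear (\<lambda>x. - T x)"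
  using bounded_clinear_scaleR[of T "-1"] by simp

lemma bounded_clinear_diff:
  "bounded_clinear S \<Longrightarrow> bounded_clinear T \<Longrightarrow> bounded_clinear (\<lambda>x. S x - T x)"
  using bounded_clinear_add[of S "\<lambda>x. - T x"] bounded_clinear_uminus[of T] by simp

lemma bounded_clinear_compose:
  "bounded_clinear S \<Longrightarrow> bounded_clinear T \<Longrightarrow> bounded_clinear (\<lambda>x. S (T x))"
  by (simp add: bounded_clinear_def bounded_linear_compose)

definition compact_operator :: "('a::complex_normed_vector \<Rightarrow> 'b::complex_normed_vector) \<Rightarrow> bool"
  where "compact_operator T \<longleftrightarrow> bounded_clinear T \<and> compact (closure (T ` ball 0 1))"

section \<open>The dual space\<close>

typedef (overloaded) 'a cdual = "{\<phi>::'a::complex_normed_vector \<Rightarrow> complex. bounded_clinear \<phi>}"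
  morphisms cdual_apply Cdual
  using bounded_clinear_zero by blast

setup_lifting type_definition_cdual

lemma cdual_eqI: "(\<And>x. cdual_apply \<phi> x = cdual_apply \<psi> x) \<Longrightarrow> \<phi> = \<psi>"
  by transfer auto

lemma bounded_clinear_cdual_apply: "bounded_clinear (cdual_apply \<phi>)"
  using cdual_apply by auto

instantiation cdual :: (complex_normed_vector) complex_normed_vector
begin

lift_definition zero_cdual :: "'a cdual" is "\<lambda>_. 0"
  by (rule bounded_clinear_zero)

lift_definition plus_cdual :: "'a cdual \<Rightarrow> 'a cdual \<Rightarrow> 'a cdual" is "\<lambda>\<phi> \<psi> x. \<phi> x + \<psi> x"
  by (rule bounded_clinear_add)

lift_definition uminus_cdual :: "'a cdual \<Rightarrow> 'a cdual" is "\<lambda>\<phi> x. - \<phi> x"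
  by (rule bounded_clinear_uminus)

lift_definition minus_cdual :: "'a cdual \<Rightarrow> 'a cdual \<Rightarrow> 'a cdual" is "\<lambda>\<phi> \<psi> x. \<phi> x - \<psi> x"
  by (rule bounded_clinear_diff)

lift_definition scaleR_cdual :: "real \<Rightarrow> 'a cdual \<Rightarrow> 'a cdual" is "\<lambda>r \<phi> x. r *\<^sub>R \<phi> x"
  by (rule bounded_clinear_scaleR)

lift_definition scaleC_cdual :: "complex \<Rightarrow> 'a cdual \<Rightarrow> 'a cdual" is "\<lambda>c \<phi> x. c *\<^sub>C \<phi> x"
  by (rule bounded_clinear_scaleC)

lift_definition norm_cdual :: "'a cdual \<Rightarrow> real" is onorm .

definition dist_cdual :: "'a cdual \<Rightarrow> 'a cdual \<Rightarrow> real"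
  where "dist_cdual \<phi> \<psi> = norm (\<phi> - \<psi>)"

definition sgn_cdual :: "'a cdual \<Rightarrow> 'a cdual"
  where "sgn_cdual \<phi> = inverse (norm \<phi>) *\<^sub>R \<phi>"

definition uniformity_cdual :: "('a cdual \<times> 'a cdual) filter"
  where "uniformity_cdual = (INF e\<in>{0<..}. principal {(\<phi>, \<psi>). dist \<phi> \<psi> < e})"

definition open_cdual :: "'a cdual set \<Rightarrow> bool"
  where "open_cdual U \<longleftrightarrow> (\<forall>\<phi>\<in>U. \<forall>\<^sub>F (\<phi>', \<psi>) in uniformity. \<phi>' = \<phi> \<longrightarrow> \<psi> \<in> U)"

instance
proof
  fix \<phi> \<psi> :: "'a cdual" and r :: real and c :: complex
  show "dist \<phi> \<psi> = norm (\<phi> - \<psi>)" by (rule dist_cdual_def)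
  show "sgn \<phi> = inverse (norm \<phi>) *\<^sub>R \<phi>" by (rule sgn_cdual_def)
  show "(uniformity :: ('a cdual \<times> 'a cdual) filter) =
      (INF e\<in>{0<..}. principal {(\<phi>, \<psi>). dist \<phi> \<psi> < e})"
    by (rule uniformity_cdual_def)
  show "open U = (\<forall>\<phi>\<in>U. \<forall>\<^sub>F (\<phi>', \<psi>) in uniformity. \<phi>' = \<phi> \<longrightarrow> \<psi> \<in> U)" for U :: "'a cdual set"
    by (rule open_cdual_def)
  show "(norm \<phi> = 0) = (\<phi> = 0)"
    by transfer (auto simp: onorm_eq_0 bounded_clinear_bounded_linear)
  show "norm (\<phi> + \<psi>) \<le> norm \<phi> + norm \<psi>"
    by transfer (simp add: onorm_triangle bounded_clinear_bounded_linear)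
  show "norm (r *\<^sub>R \<phi>) = \<bar>r\<bar> * norm \<phi>"
    by transfer (simp add: onorm_scaleR bounded_clinear_bounded_linear)
  have eq: "onorm (\<lambda>x. c *\<^sub>C f x) = cmod c * onorm f"
    if "bounded_clinear f" for f :: "'a \<Rightarrow> complex" and c
  proof -
    have "onorm (\<lambda>x. c *\<^sub>C f x) = onorm (\<lambda>x. cmod c *\<^sub>R f x)"
      by (simp add: onorm_def norm_scaleC)
    then show ?thesis
      using onorm_scaleR[OF bounded_clinear_bounded_linear[OF that], of "cmod c"] by simp
  qed
  show "norm (c *\<^sub>C \<phi>) = cmod c * norm \<phi>"
    by transfer (rule eq)
  show "r *\<^sub>R \<phi> = complex_of_real r *\<^sub>C \<phi>"
    by transfer (rule ext, rule scaleR_scaleC)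
qed (transfer; simp add: fun_eq_iff scaleC_add_right scaleC_add_left scaleC_scaleC algebra_simps)+

end

section \<open>Weak, weak* and bounded weak* topologies\<close>

definition weak_topology :: "'a::complex_normed_vector topology"
  where "weak_topology = topology_generated_by
    {{x. cdual_apply \<phi> x \<in> U} | \<phi> U. open U}"

definition weak_star_topology :: "'a::complex_normed_vector cdual topology"
  where "weak_star_topology = topology_generated_by
    {{\<phi>. cdual_apply \<phi> x \<in> U} | x U. open U}"

definition agrees_weak_star_on_bounded :: "'a::complex_normed_vector cdual topology \<Rightarrow> bool"
  where "agrees_weak_star_on_bounded T \<longleftrightarrow> topspace T = UNIV \<and>
    (\<forall>B. bounded B \<longrightarrow> subtopology T B = subtopology weak_star_topology B)"

definition bounded_weak_star_topology :: "'a::complex_normed_vector cdual topology"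
  where "bounded_weak_star_topology = (THE T. agrees_weak_star_on_bounded T \<and>
    (\<forall>S. agrees_weak_star_on_bounded S \<longrightarrow> (\<forall>U. openin S U \<longrightarrow> openin T U)))"

lemma topspace_weak_star_topology [simp]:
  "topspace (weak_star_topology :: 'a::complex_normed_vector cdual topology) = UNIV"
proof -
  have "UNIV \<in> {{\<phi>::'a cdual. cdual_apply \<phi> x \<in> U} | x U. open U}"
    by (intro CollectI exI[of _ 0] exI[of _ UNIV]) simp
  then show ?thesis
    unfolding weak_star_topology_def topology_generated_by_topspace by blast
qed

text \<open>
  A finest topology agreeing with the weak* topology on bounded sets exists, so the definite
  description above is meaningful.
\<close>

lemma
  fixes U V :: "'a::complex_normed_vector cdual set"
  shows openin_bounded_weak_star_topology: "openin bounded_weak_star_topology U \<longleftrightarrow>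
    (\<forall>B. bounded B \<longrightarrow> openin (subtopology weak_star_topology B) (U \<inter> B))" (is ?open)
  and agrees_bounded_weak_star_topology:
    "agrees_weak_star_on_bounded (bounded_weak_star_topology :: 'a cdual topology)" (is ?agrees)
  and finest_bounded_weak_star_topology:
    "agrees_weak_star_on_bounded S \<Longrightarrow> openin S V \<Longrightarrow> openin bounded_weak_star_topology V"
proof -
  let ?W = "weak_star_topology :: 'a cdual topology"
  define P where "P U \<longleftrightarrow> (\<forall>B. bounded B \<longrightarrow> openin (subtopology ?W B) (U \<inter> B))" for U
  define T where "T = topology P"
  have "istopology P"
    unfolding istopology_def
  proof (intro conjI allI impI)
    fix U V assume "P U" "P V"
    show "P (U \<inter> V)"
      unfolding P_def
    proof (intro allI impI)
      fix B :: "'a cdual set" assume "bounded B"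
      then have "openin (subtopology ?W B) ((U \<inter> B) \<inter> (V \<inter> B))"
        using \<open>P U\<close> \<open>P V\<close> by (intro openin_Int[of _ "U \<inter> B" "V \<inter> B"]) (simp_all add: P_def)
      moreover have "(U \<inter> B) \<inter> (V \<inter> B) = (U \<inter> V) \<inter> B" by blast
      ultimately show "openin (subtopology ?W B) ((U \<inter> V) \<inter> B)" by simp
    qed
  next
    fix K assume "\<forall>U\<in>K. P U"
    show "P (\<Union>K)"
      unfolding P_def
    proof (intro allI impI)
      fix B :: "'a cdual set" assume "bounded B"
      then have "openin (subtopology ?W B) (\<Union>U\<in>K. U \<inter> B)"
        using \<open>\<forall>U\<in>K. P U\<close> by (intro openin_Union) (auto simp: P_def)
      moreover have "(\<Union>U\<in>K. U \<inter> B) = \<Union>K \<inter> B" by blast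
      ultimately show "openin (subtopology ?W B) (\<Union>K \<inter> B)" by simp
    qed
  qed
  then have T: "openin T = P"
    by (simp add: T_def topology_inverse')
  have W_T: "openin T U" if "openin ?W U" for U
    using that by (auto simp: T P_def openin_subtopology)
  have agr: "agrees_weak_star_on_bounded T"
    unfolding agrees_weak_star_on_bounded_def
  proof (intro conjI allI impI)
    show "topspace T = UNIV"
      using openin_subset[OF W_T[OF openin_topspace]] by (simp add: top.extremum_unique)
    fix B :: "'a cdual set" assume "bounded B"
    show "subtopology T B = subtopology ?W B"
      unfolding topology_eq
    proof (intro allI iffI)
      fix V assume "openin (subtopology T B) V"
      then obtain U where "openin T U" "V = U \<inter> B" by (auto simp: openin_subtopology)
      then show "openin (subtopology ?W B) V"
        using \<open>bounded B\<close> by (simp add: T P_def)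
    next
      fix V assume "openin (subtopology ?W B) V"
      then show "openin (subtopology T B) V"
        using W_T by (auto simp: openin_subtopology)
    qed
  qed
  have finest: "openin T U" if "agrees_weak_star_on_bounded S" "openin S U" for S U
    unfolding T P_def
  proof (intro allI impI)
    fix B :: "'a cdual set" assume "bounded B"
    with that(1) have "subtopology S B = subtopology ?W B"
      by (simp add: agrees_weak_star_on_bounded_def)
    then show "openin (subtopology ?W B) (U \<inter> B)"
      using openin_subtopology_Int[OF that(2), of B] by simp
  qed
  have "bounded_weak_star_topology = T"
    unfolding bounded_weak_star_topology_def
  proof (rule the_equality)
    show "agrees_weak_star_on_bounded T \<and>
      (\<forall>S. agrees_weak_star_on_bounded S \<longrightarrow> (\<forall>U. openin S U \<longrightarrow> openin T U))"
      using agr finest by blast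
    show "T' = T" if "agrees_weak_star_on_bounded T' \<and>
      (\<forall>S. agrees_weak_star_on_bounded S \<longrightarrow> (\<forall>U. openin S U \<longrightarrow> openin T' U))" for T'
      unfolding topology_eq using that agr finest by blast
  qed
  with agr finest T show ?open ?agrees
    "agrees_weak_star_on_bounded S \<Longrightarrow> openin S V \<Longrightarrow> openin bounded_weak_star_topology V"
    by (simp_all only: P_def)
qed

section \<open>Holomorphic Lipschitz maps on the open unit ball\<close>

definition cholomorphic_on ::
    "('a::complex_normed_vector \<Rightarrow> 'b::complex_normed_vector) \<Rightarrow> 'a set \<Rightarrow> bool"
  where "cholomorphic_on f U \<longleftrightarrow>
    (\<forall>x\<in>U. \<exists>D. bounded_clinear D \<and> (f has_derivative D) (at x))"

text \<open>
  Only the values on the open unit ball are meaningful.  Outside of it the representing total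
  function is fixed to be \<open>0\<close>, so that two elements are equal iff they agree on the ball.
\<close>

typedef (overloaded) ('a, 'b) hol_lip =
  "{f :: 'a::complex_normed_vector \<Rightarrow> 'b::complex_normed_vector.
      cholomorphic_on f (ball 0 1) \<and> (\<exists>C. C-lipschitz_on (ball 0 1) f) \<and> f 0 = 0 \<and>
      (\<forall>x. x \<notin> ball 0 1 \<longrightarrow> f x = 0)}"
  morphisms hol_lip_apply Hol_lip
proof -
  have "0-lipschitz_on (ball 0 1) (\<lambda>_::'a. 0::'b)"
    by (rule lipschitz_onI) auto
  then show ?thesis
    by (intro exI[of _ "\<lambda>_. 0"])
      (auto simp: cholomorphic_on_def intro!: exI[of _ "\<lambda>_. 0"] bounded_clinear_zero)
qed

setup_lifting type_definition_hol_lip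

lemma hol_lip_eqI: "(\<And>x. hol_lip_apply f x = hol_lip_apply g x) \<Longrightarrow> f = g"
  by transfer auto

text \<open>
  The supremum below always includes \<open>0\<close>, which only matters for the trivial space, where there
  are no two distinct points.
\<close>

definition lip_norm :: "('a::complex_normed_vector \<Rightarrow> 'b::complex_normed_vector) \<Rightarrow> real"
  where "lip_norm f = Sup (insert 0
    {norm (f x - f y) / norm (x - y) | x y. x \<in> ball 0 1 \<and> y \<in> ball 0 1 \<and> x \<noteq> y})"

lemma lip_norm_le:
  assumes "0 \<le> C"
    and "\<And>x y. x \<in> ball 0 1 \<Longrightarrow> y \<in> ball 0 1 \<Longrightarrow> norm (f x - f y) \<le> C * norm (x - y)"
  shows "lip_norm f \<le> C"
  unfolding lip_norm_def using assms
  by (intro cSup_least) (auto simp: pos_divide_le_eq)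

lemma lip_norm_bdd:
  fixes f :: "'a::complex_normed_vector \<Rightarrow> 'b::complex_normed_vector"
  assumes "C-lipschitz_on (ball 0 1) f"
  shows "bdd_above (insert 0
    {norm (f x - f y) / norm (x - y) | x y. x \<in> ball 0 1 \<and> y \<in> ball 0 1 \<and> x \<noteq> y})"
proof (rule bdd_aboveI)
  fix t assume "t \<in> insert 0
    {norm (f x - f y) / norm (x - y) | x y. x \<in> ball 0 1 \<and> y \<in> ball 0 1 \<and> x \<noteq> y}"
  then show "t \<le> C"
    using lipschitz_on_nonneg[OF assms] lipschitz_onD[OF assms]
    by (auto simp: pos_divide_le_eq dist_norm)
qed

lemma lip_norm_nonneg: "C-lipschitz_on (ball 0 1) f \<Longrightarrow> 0 \<le> lip_norm f"
  unfolding lip_norm_def by (intro cSup_upper lip_norm_bdd) auto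

lemma lip_norm_bound:
  assumes "C-lipschitz_on (ball 0 1) f" "x \<in> ball 0 1" "y \<in> ball 0 1"
  shows "norm (f x - f y) \<le> lip_norm f * norm (x - y)"
proof (cases "x = y")
  case False
  then have "norm (f x - f y) / norm (x - y) \<le> lip_norm f"
    unfolding lip_norm_def using assms by (intro cSup_upper lip_norm_bdd) auto
  with False show ?thesis by (simp add: divide_simps)
qed simp

lemma lipschitz_on_clinear:
  assumes "bounded_clinear T" "\<exists>C. C-lipschitz_on A f"
  shows "\<exists>C. C-lipschitz_on A (\<lambda>x. T (f x))"
proof -
  interpret T: bounded_linear T using assms(1) by (rule bounded_clinear_bounded_linear)
  obtain C where "C-lipschitz_on A f" using assms(2) by blast
  then show ?thesis
    using T.lipschitz_boundE lipschitz_on_compose2 by metis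
qed

lemma cholomorphic_on_clinear:
  assumes "bounded_clinear T" "cholomorphic_on f A"
  shows "cholomorphic_on (\<lambda>x. T (f x)) A"
  unfolding cholomorphic_on_def
proof
  fix x assume "x \<in> A"
  then obtain D where D: "bounded_clinear D" "(f has_derivative D) (at x)"
    using assms(2) unfolding cholomorphic_on_def by blast
  then show "\<exists>D. bounded_clinear D \<and> ((\<lambda>x. T (f x)) has_derivative D) (at x)"
    using bounded_linear.has_derivative[OF bounded_clinear_bounded_linear[OF assms(1)] D(2)]
      bounded_clinear_compose[OF assms(1) D(1)] by blast
qed

lemma cholomorphic_on_add:
  assumes "cholomorphic_on f A" "cholomorphic_on g A"
  shows "cholomorphic_on (\<lambda>x. f x + g x) A"
  using assms unfolding cholomorphic_on_def
  by (blast intro: bounded_clinear_add has_derivative_add)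

lemma cholomorphic_on_uminus: "cholomorphic_on f A \<Longrightarrow> cholomorphic_on (\<lambda>x. - f x) A"
  unfolding cholomorphic_on_def
  by (blast intro: bounded_clinear_uminus has_derivative_minus)

lemma cholomorphic_on_diff:
  "cholomorphic_on f A \<Longrightarrow> cholomorphic_on g A \<Longrightarrow> cholomorphic_on (\<lambda>x. f x - g x) A"
  using cholomorphic_on_add[of f A "\<lambda>x. - g x"] cholomorphic_on_uminus[of g A] by simp

lemma bounded_clinear_scale: "bounded_clinear (\<lambda>x::'a::complex_normed_vector. c *\<^sub>C x)"
  using bounded_clinear_scaleC[of "\<lambda>x. x" c] by (simp add: bounded_clinear_def)

lemma bounded_clinear_real_scale: "bounded_clinear (\<lambda>x::'a::complex_normed_vector. r *\<^sub>R x)"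
  using bounded_clinear_scale[of "complex_of_real r"] by (simp add: scaleR_scaleC)

instantiation hol_lip :: (complex_normed_vector, complex_normed_vector) complex_normed_vector
begin

lift_definition zero_hol_lip :: "('a, 'b) hol_lip" is "\<lambda>_. 0"
  using hol_lip_apply
  by (auto simp: cholomorphic_on_def intro!: exI[of _ "\<lambda>_. 0"] bounded_clinear_zero
      exI[of _ 0] lipschitz_onI)

lift_definition plus_hol_lip :: "('a, 'b) hol_lip \<Rightarrow> ('a, 'b) hol_lip \<Rightarrow> ('a, 'b) hol_lip"
  is "\<lambda>f g x. f x + g x"
  using lipschitz_on_add by (fastforce intro: cholomorphic_on_add)

lift_definition uminus_hol_lip :: "('a, 'b) hol_lip \<Rightarrow> ('a, 'b) hol_lip" is "\<lambda>f x. - f x"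
  using lipschitz_on_minus by (auto intro: cholomorphic_on_uminus)

lift_definition minus_hol_lip :: "('a, 'b) hol_lip \<Rightarrow> ('a, 'b) hol_lip \<Rightarrow> ('a, 'b) hol_lip"
  is "\<lambda>f g x. f x - g x"
  using lipschitz_on_diff by (fastforce intro: cholomorphic_on_diff)

lift_definition scaleR_hol_lip :: "real \<Rightarrow> ('a, 'b) hol_lip \<Rightarrow> ('a, 'b) hol_lip"
  is "\<lambda>r f x. r *\<^sub>R f x"
  by (auto intro: cholomorphic_on_clinear[OF bounded_clinear_real_scale]
      lipschitz_on_clinear[OF bounded_clinear_real_scale, simplified])

lift_definition scaleC_hol_lip :: "complex \<Rightarrow> ('a, 'b) hol_lip \<Rightarrow> ('a, 'b) hol_lip"
  is "\<lambda>c f x. c *\<^sub>C f x"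
  by (auto intro: cholomorphic_on_clinear[OF bounded_clinear_scale]
      lipschitz_on_clinear[OF bounded_clinear_scale, simplified])

lift_definition norm_hol_lip :: "('a, 'b) hol_lip \<Rightarrow> real" is lip_norm .

definition dist_hol_lip :: "('a, 'b) hol_lip \<Rightarrow> ('a, 'b) hol_lip \<Rightarrow> real"
  where "dist_hol_lip f g = norm (f - g)"

definition sgn_hol_lip :: "('a, 'b) hol_lip \<Rightarrow> ('a, 'b) hol_lip"
  where "sgn_hol_lip f = inverse (norm f) *\<^sub>R f"

definition uniformity_hol_lip :: "(('a, 'b) hol_lip \<times> ('a, 'b) hol_lip) filter"
  where "uniformity_hol_lip = (INF e\<in>{0<..}. principal {(f, g). dist f g < e})"

definition open_hol_lip :: "('a, 'b) hol_lip set \<Rightarrow> bool"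
  where "open_hol_lip U \<longleftrightarrow> (\<forall>f\<in>U. \<forall>\<^sub>F (f', g) in uniformity. f' = f \<longrightarrow> g \<in> U)"

instance
proof
  fix f g :: "('a, 'b) hol_lip" and r :: real and c :: complex
  show "dist f g = norm (f - g)" by (rule dist_hol_lip_def)
  show "sgn f = inverse (norm f) *\<^sub>R f" by (rule sgn_hol_lip_def)
  show "(uniformity :: (('a, 'b) hol_lip \<times> ('a, 'b) hol_lip) filter) =
      (INF e\<in>{0<..}. principal {(f, g). dist f g < e})"
    by (rule uniformity_hol_lip_def)
  show "open U = (\<forall>f\<in>U. \<forall>\<^sub>F (f', g) in uniformity. f' = f \<longrightarrow> g \<in> U)" for U :: "('a, 'b) hol_lip set"
    by (rule open_hol_lip_def)
  have scale: "lip_norm (\<lambda>x. c *\<^sub>C h x) = cmod c * lip_norm h"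
    if h: "\<exists>C. C-lipschitz_on (ball 0 1) h" for c and h :: "'a \<Rightarrow> 'b"
  proof -
    have le: "lip_norm (\<lambda>x. c *\<^sub>C h x) \<le> cmod c * lip_norm h"
      if h: "\<exists>C. C-lipschitz_on (ball 0 1) h" for c and h :: "'a \<Rightarrow> 'b"
    proof (rule lip_norm_le)
      show "0 \<le> cmod c * lip_norm h"
        using h lip_norm_nonneg by (metis mult_nonneg_nonneg norm_ge_zero)
      fix x y :: 'a assume xy: "x \<in> ball 0 1" "y \<in> ball 0 1"
      have "norm (c *\<^sub>C h x - c *\<^sub>C h y) = cmod c * norm (h x - h y)"
        by (metis norm_scaleC scaleC_diff_right)
      also have "\<dots> \<le> cmod c * (lip_norm h * norm (x - y))"
        using h lip_norm_bound xy by (blast intro: mult_left_mono norm_ge_zero)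
      finally show "norm (c *\<^sub>C h x - c *\<^sub>C h y) \<le> cmod c * lip_norm h * norm (x - y)"
        by (simp add: mult.assoc)
    qed
    show ?thesis
    proof (cases "c = 0")
      case True
      have "lip_norm (\<lambda>x. c *\<^sub>C h x) \<le> 0" using le[OF h, of c] True by simp
      moreover have "0 \<le> lip_norm (\<lambda>x. c *\<^sub>C h x)"
        using lipschitz_on_clinear[OF bounded_clinear_scale h] lip_norm_nonneg by blast
      ultimately show ?thesis using True by simp
    next
      case False
      have "(\<lambda>x. inverse c *\<^sub>C c *\<^sub>C h x) = h"
        using False by (simp add: scaleC_scaleC scaleC_one)
      then have "lip_norm h \<le> cmod (inverse c) * lip_norm (\<lambda>x. c *\<^sub>C h x)"
        using le[OF lipschitz_on_clinear[OF bounded_clinear_scale h], of "inverse c" c] by simp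
      then have "cmod c * lip_norm h \<le> lip_norm (\<lambda>x. c *\<^sub>C h x)"
        using False by (simp add: norm_inverse norm_divide field_simps)
      with le[OF h, of c] show ?thesis by simp
    qed
  qed
  show "norm (c *\<^sub>C f) = cmod c * norm f"
    by transfer (use scale in blast)
  show "norm (r *\<^sub>R f) = \<bar>r\<bar> * norm f"
  proof transfer
    fix r :: real and f :: "'a \<Rightarrow> 'b"
    assume "cholomorphic_on f (ball 0 1) \<and> (\<exists>C. C-lipschitz_on (ball 0 1) f) \<and> f 0 = 0 \<and>
      (\<forall>x. x \<notin> ball 0 1 \<longrightarrow> f x = 0)"
    then show "lip_norm (\<lambda>x. r *\<^sub>R f x) = \<bar>r\<bar> * lip_norm f"
      using scale[of f "complex_of_real r"] by (simp add: scaleR_scaleC)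
  qed
  show "(norm f = 0) = (f = 0)"
  proof transfer
    fix f :: "'a \<Rightarrow> 'b"
    assume f: "cholomorphic_on f (ball 0 1) \<and> (\<exists>C. C-lipschitz_on (ball 0 1) f) \<and> f 0 = 0 \<and>
      (\<forall>x. x \<notin> ball 0 1 \<longrightarrow> f x = 0)"
    show "(lip_norm f = 0) = (f = (\<lambda>_. 0))"
    proof
      assume 0: "lip_norm f = 0"
      show "f = (\<lambda>_. 0)"
      proof
        fix x show "f x = 0"
          using f 0 lip_norm_bound[of _ f x 0] by (cases "x \<in> ball 0 1") auto
      qed
    next
      assume "f = (\<lambda>_. 0)"
      then have "lip_norm f \<le> 0" by (intro lip_norm_le) auto
      with f lip_norm_nonneg[of _ f] show "lip_norm f = 0" by (metis order_antisym)
    qed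
  qed
  show "norm (f + g) \<le> norm f + norm g"
  proof transfer
    fix f g :: "'a \<Rightarrow> 'b"
    assume "cholomorphic_on f (ball 0 1) \<and> (\<exists>C. C-lipschitz_on (ball 0 1) f) \<and> f 0 = 0 \<and>
        (\<forall>x. x \<notin> ball 0 1 \<longrightarrow> f x = 0)"
      and "cholomorphic_on g (ball 0 1) \<and> (\<exists>C. C-lipschitz_on (ball 0 1) g) \<and> g 0 = 0 \<and>
        (\<forall>x. x \<notin> ball 0 1 \<longrightarrow> g x = 0)"
    then obtain C D where CD: "C-lipschitz_on (ball 0 1) f" "D-lipschitz_on (ball 0 1) g"
      by blast
    show "lip_norm (\<lambda>x. f x + g x) \<le> lip_norm f + lip_norm g"
    proof (rule lip_norm_le)
      show "0 \<le> lip_norm f + lip_norm g"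
        using CD lip_norm_nonneg by (metis add_nonneg_nonneg)
      fix x y :: 'a assume xy: "x \<in> ball 0 1" "y \<in> ball 0 1"
      have "norm (f x + g x - (f y + g y)) \<le> norm (f x - f y) + norm (g x - g y)"
        by (rule norm_diff_triangle_ineq)
      also have "\<dots> \<le> (lip_norm f + lip_norm g) * norm (x - y)"
        using lip_norm_bound[OF CD(1) xy] lip_norm_bound[OF CD(2) xy]
        by (simp add: distrib_right)
      finally show "norm (f x + g x - (f y + g y)) \<le> (lip_norm f + lip_norm g) * norm (x - y)" .
    qed
  qed
  show "r *\<^sub>R f = complex_of_real r *\<^sub>C f"
    by transfer (rule ext, rule scaleR_scaleC)
qed (transfer; simp add: fun_eq_iff scaleC_add_right scaleC_add_left scaleC_scaleC algebra_simps)+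

end

definition lipschitz_image ::
    "('a::complex_normed_vector, 'b::complex_normed_vector) hol_lip \<Rightarrow> 'b set"
  where "lipschitz_image f =
    {(hol_lip_apply f x - hol_lip_apply f y) /\<^sub>R norm (x - y) | x y.
      x \<in> ball 0 1 \<and> y \<in> ball 0 1 \<and> x \<noteq> y}"

definition compact_hol_lip ::
    "('a::complex_normed_vector, 'b::complex_normed_vector) hol_lip \<Rightarrow> bool"
  where "compact_hol_lip f \<longleftrightarrow> compact (closure (lipschitz_image f))"

lift_definition hol_lip_transpose ::
    "('a::complex_normed_vector, 'b::complex_normed_vector) hol_lip \<Rightarrow>
      'b cdual \<Rightarrow> ('a, complex) hol_lip"
  is "\<lambda>f \<phi> x. \<phi> (f x)"
  using cholomorphic_on_clinear lipschitz_on_clinear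
  by (fastforce simp: linear_0 bounded_linear.linear dest: bounded_clinear_bounded_linear)

end

theory Submission
  imports Defs
begin

text \<open>
  Write \<open>T\<close> for the transpose and \<open>D\<close> for the Lipschitz image of \<open>f\<close>.  Everything rests on the
  identity \<open>norm (T \<phi>) = sup {cmod (\<phi> d) | d \<in> D}\<close>, which turns statements about \<open>T\<close> into
  statements about functionals on \<open>D\<close>.

  If \<open>D\<close> is relatively compact, it has finite nets, so on bounded sets of functionals uniform
  closeness on \<open>D\<close> is controlled by finitely many points; this makes \<open>T\<close> continuous from the
  bounded weak* topology to the norm (\<open>compact_imp_bounded_weak_star_continuous\<close>).  Such a \<open>T\<close>
  is compact because the dual ball is weak* compact
  (\<open>bounded_weak_star_continuous_imp_compact_operator\<close>).  If \<open>T\<close> is compact, finitely many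
  functionals approximate the whole dual ball uniformly on \<open>D\<close>, and norming functionals show that
  \<open>D\<close> is totally bounded (\<open>compact_transpose_imp_compact\<close>).

  The two conditions involving the weak topology contain compactness of \<open>T\<close>, so it remains to
  derive the stronger of them, weak*-to-weak continuity.  For a functional \<open>\<psi>\<close> on the
  function space, \<open>\<psi> \<circ> T\<close> must be an evaluation at a point of \<open>Y\<close>.  It is dominated by a
  multiple of the supremum over \<open>D\<close>, hence, by a finite net, by a small multiple of the norm plus a
  finite sum of moduli of evaluations.  A sandwich form of the Hahn-Banach theorem
  (\<open>linear_split_sublinear\<close>) removes the evaluations one by one, so \<open>\<psi> \<circ> T\<close> is
  approximated in norm by evaluations, and completeness of \<open>Y\<close> finishes the argument
  (\<open>evaluation_of_compactly_dominated\<close>).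

  The Hahn-Banach theorem takes the form that every sublinear functional dominates a linear one
  (\<open>linear_below_sublinear\<close>).
\<close>

section \<open>Sublinear functionals and the Hahn-Banach theorem\<close>

definition sublinear :: "('v::real_vector \<Rightarrow> real) \<Rightarrow> bool"
  where "sublinear p \<longleftrightarrow>
    (\<forall>x y. p (x + y) \<le> p x + p y) \<and> (\<forall>c x. 0 \<le> c \<longrightarrow> p (c *\<^sub>R x) = c * p x)"

lemma sublinear_add: "sublinear p \<Longrightarrow> p (x + y) \<le> p x + p y"
  and sublinear_scale: "sublinear p \<Longrightarrow> 0 \<le> c \<Longrightarrow> p (c *\<^sub>R x) = c * p x"
  by (auto simp: sublinear_def)

lemma sublinear_zero: "sublinear p \<Longrightarrow> p 0 = 0"
  using sublinear_scale[of p 0 0] by simp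

lemma sublinear_minus: "sublinear p \<Longrightarrow> - p (- x) \<le> p x"
  using sublinear_add[of p x "- x"] by (simp add: sublinear_zero)

lemma sublinear_norm: "sublinear norm"
  by (simp add: sublinear_def norm_triangle_ineq)

text \<open>
  An infimum of sublinear functionals is in general not subadditive.  It is when two members of
  the family can be combined into a third one as required below.  Besides chains, this covers
  families whose members are not sublinear one by one, such as the translates in
  \<open>sublinear_descend\<close> and the infimal convolution in \<open>linear_split_sublinear\<close>.
\<close>

lemma sublinear_INF:
  fixes h :: "'i \<Rightarrow> 'v::real_vector \<Rightarrow> real"
  assumes add: "\<And>i j x y. i \<in> I \<Longrightarrow> j \<in> I \<Longrightarrow> \<exists>k\<in>I. h k (x + y) \<le> h i x + h j y"
    and scale: "\<And>c i x. 0 < c \<Longrightarrow> i \<in> I \<Longrightarrow> \<exists>k\<in>I. h k (c *\<^sub>R x) \<le> c * h i x"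
    and zero: "\<exists>i\<in>I. h i 0 \<le> 0"
    and bdd: "\<And>x. bdd_below ((\<lambda>i. h i x) ` I)"
  shows "sublinear (\<lambda>x. INF i\<in>I. h i x)" (is "sublinear ?s")
proof -
  have ne: "I \<noteq> {}" using zero by blast
  have low: "?s x \<le> h i x" if "i \<in> I" for i x
    using bdd that by (rule cINF_lower)
  have great: "r \<le> ?s x" if "\<And>i. i \<in> I \<Longrightarrow> r \<le> h i x" for r x
    using ne that by (rule cINF_greatest)
  have sub: "?s (x + y) \<le> ?s x + ?s y" for x y
  proof -
    have *: "?s (x + y) \<le> h i x + h j y" if "i \<in> I" "j \<in> I" for i j
      using add[OF that, of x y] low order_trans by blast
    have "?s (x + y) - h i x \<le> ?s y" if "i \<in> I" for i
    proof (rule great)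
      show "?s (x + y) - h i x \<le> h j y" if "j \<in> I" for j
        using *[OF \<open>i \<in> I\<close> that] by linarith
    qed
    then have "?s (x + y) - ?s y \<le> h i x" if "i \<in> I" for i
      using that by (simp add: diff_le_eq add.commute)
    then have "?s (x + y) - ?s y \<le> ?s x" by (rule great)
    then show ?thesis by simp
  qed
  have le: "?s (c *\<^sub>R x) \<le> c * ?s x" if "0 < c" for c x
  proof -
    have "?s (c *\<^sub>R x) / c \<le> ?s x"
    proof (rule great)
      fix i assume "i \<in> I"
      then have "?s (c *\<^sub>R x) \<le> c * h i x"
        using scale[OF that, of i x] low order_trans by blast
      then show "?s (c *\<^sub>R x) / c \<le> h i x"
        using that by (simp add: pos_divide_le_eq mult.commute)
    qed
    then show ?thesis using that by (simp add: pos_divide_le_eq mult.commute)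
  qed
  have "?s 0 = 0"
  proof (rule antisym)
    show "?s 0 \<le> 0" using zero low order_trans by blast
    show "0 \<le> ?s 0" using sub[of 0 0] by simp
  qed
  moreover have "?s (c *\<^sub>R x) = c * ?s x" if "0 < c" for c x
  proof (rule antisym[OF le[OF that]])
    have "?s (inverse c *\<^sub>R c *\<^sub>R x) \<le> inverse c * ?s (c *\<^sub>R x)"
      using that by (intro le) simp
    then show "c * ?s x \<le> ?s (c *\<^sub>R x)"
      using that by (simp add: field_simps)
  qed
  ultimately have "?s (c *\<^sub>R x) = c * ?s x" if "0 \<le> c" for c x
    using that by (cases "c = 0") auto
  with sub show ?thesis by (simp add: sublinear_def)
qed

text \<open>
  The new functional is \<open>q x = inf {p (x + t a) - t p a | t \<ge> 0}\<close>: the choice \<open>t = 0\<close> gives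
  \<open>q \<le> p\<close> and \<open>t = 1\<close> gives the bound at \<open>- a\<close>.  A linear functional below \<open>q\<close> must take the
  value \<open>p a\<close> at \<open>a\<close>, and a \<open>p\<close> that is minimal equals \<open>q\<close>, hence is odd.  Both uses together
  give the Hahn-Banach theorem.
\<close>

lemma sublinear_descend:
  assumes p: "sublinear p"
  obtains q where "sublinear q" "\<And>x. q x \<le> p x" "q (- a) \<le> - p a"
proof -
  define h where "h t x = p (x + t *\<^sub>R a) - t * p a" for t x
  define q where "q x = (INF t\<in>{0..}. h t x)" for x
  have bdd: "bdd_below ((\<lambda>t. h t x) ` {0..})" for x
  proof (rule bdd_belowI2)
    fix t :: real assume "t \<in> {0..}"
    then have "t * p a \<le> p (x + t *\<^sub>R a) + p (- x)"
      using sublinear_add[OF p, of "x + t *\<^sub>R a" "- x"] by (simp add: sublinear_scale[OF p])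
    then show "- p (- x) \<le> h t x" by (simp add: h_def)
  qed
  have low: "q x \<le> h t x" if "0 \<le> t" for t x
    unfolding q_def using bdd that by (intro cINF_lower) auto
  have "sublinear q"
    unfolding q_def
  proof (rule sublinear_INF)
    show "\<exists>k\<in>{0..}. h k (x + y) \<le> h i x + h j y" if "i \<in> {0..}" "j \<in> {0..}" for i j x y
      using that sublinear_add[OF p, of "x + i *\<^sub>R a" "y + j *\<^sub>R a"]
      by (intro bexI[of _ "i + j"]) (auto simp: h_def algebra_simps)
    show "\<exists>k\<in>{0..}. h k (c *\<^sub>R x) \<le> c * h i x" if "0 < c" "i \<in> {0..}" for c i x
      using that sublinear_scale[OF p, of c "x + i *\<^sub>R a"]
      by (intro bexI[of _ "c * i"]) (auto simp: h_def algebra_simps)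
    show "\<exists>i\<in>{0..}. h i 0 \<le> 0"
      by (intro bexI[of _ 0]) (auto simp: h_def sublinear_zero[OF p])
  qed (rule bdd)
  moreover have "q x \<le> p x" for x using low[of 0 x] by (simp add: h_def)
  moreover have "q (- a) \<le> - p a"
    using low[of 1 "- a"] by (simp add: h_def sublinear_zero[OF p])
  ultimately show ?thesis using that by blast
qed

text \<open>
  By Zorn's lemma there is a minimal sublinear functional below \<open>p\<close>; descending at an arbitrary
  \<open>a\<close> cannot change it, so it is odd, and an odd sublinear functional is linear.
\<close>

lemma linear_below_sublinear:
  fixes p :: "'v::real_vector \<Rightarrow> real"
  assumes p: "sublinear p"
  obtains l where "linear l" "\<And>x. l x \<le> p x"
proof -
  define A where "A = {q. sublinear q \<and> q \<le> p}"
  let ?R = "relation_of (\<lambda>q r. r \<le> q) A"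
  have "\<exists>m\<in>A. \<forall>q\<in>A. q \<le> m \<longrightarrow> q = m"
  proof (rule predicate_Zorn)
    show "partial_order_on A ?R"
      by (rule partial_order_on_relation_ofI) auto
    fix C assume C: "C \<in> Chains ?R"
    then have CA: "C \<subseteq> A" and chain: "\<And>q r. q \<in> C \<Longrightarrow> r \<in> C \<Longrightarrow> q \<le> r \<or> r \<le> q"
      by (auto simp: Chains_def relation_of_def)
    show "\<exists>u\<in>A. \<forall>q\<in>C. u \<le> q"
    proof (cases "C = {}")
      case True
      then show ?thesis using p by (auto simp: A_def)
    next
      case False
      define u where "u x = (INF q\<in>C. q x)" for x
      have bdd: "bdd_below ((\<lambda>q. q x) ` C)" for x
      proof (rule bdd_belowI2)
        fix q assume "q \<in> C"
        then have "sublinear q" "q (- x) \<le> p (- x)"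
          using CA by (auto simp: A_def le_fun_def)
        then show "- p (- x) \<le> q x" using sublinear_minus[of q x] by linarith
      qed
      have low: "u x \<le> q x" if "q \<in> C" for q x
        unfolding u_def using bdd that by (intro cINF_lower) auto
      have "sublinear u"
        unfolding u_def
      proof (rule sublinear_INF)
        show "\<exists>k\<in>C. k (x + y) \<le> i x + j y" if "i \<in> C" "j \<in> C" for i j x y
        proof -
          have *: "k (x + y) \<le> i x + j y" if "k \<in> C" "k \<le> i" "k \<le> j" for k
            using that CA sublinear_add[of k x y] le_funD[OF that(2), of x] le_funD[OF that(3), of y]
            by (auto simp: A_def)
          from chain[OF that] show ?thesis using *[of i] *[of j] that by blast
        qed
        show "\<exists>k\<in>C. k (c *\<^sub>R x) \<le> c * i x" if "0 < c" "i \<in> C" for c i x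
          using that CA sublinear_scale[of i c x] by (auto simp: A_def intro!: bexI[of _ i])
        show "\<exists>i\<in>C. i 0 \<le> 0" using False CA by (force simp: A_def sublinear_zero)
      qed (rule bdd)
      moreover obtain q where "q \<in> C" using False by blast
      then have "u \<le> q" "q \<le> p" using low CA by (auto simp: A_def le_fun_def)
      then have "u \<le> p" by (rule order_trans)
      ultimately show ?thesis
        using low by (intro bexI[of _ u]) (auto simp: A_def le_fun_def)
    qed
  qed
  then obtain l where l: "sublinear l" "l \<le> p" and min: "\<And>q. sublinear q \<Longrightarrow> q \<le> l \<Longrightarrow> q = l"
    by (auto simp: A_def intro: order_trans)
  have neg: "l (- a) = - l a" for a
  proof -
    obtain q where q: "sublinear q" "\<And>x. q x \<le> l x" "q (- a) \<le> - l a"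
      using sublinear_descend[OF l(1), of a] by blast
    then have "q = l" using min by (auto simp: le_fun_def)
    then show ?thesis using q(3) sublinear_minus[OF l(1), of "- a"] by simp
  qed
  have "l (x + y) = l x + l y" for x y
    using sublinear_add[OF l(1), of x y] sublinear_add[OF l(1), of "x + y" "- y"] neg[of y] by simp
  moreover have "l (c *\<^sub>R x) = c *\<^sub>R l x" for c x
    using sublinear_scale[OF l(1), of c x] sublinear_scale[OF l(1), of "- c" x] neg[of "c *\<^sub>R x"]
    by (cases "0 \<le> c") auto
  ultimately have "linear l" by (rule linearI)
  then show ?thesis using that l(2) by (auto simp: le_fun_def)
qed

text \<open>
  The part \<open>m\<close> has to satisfy \<open>m x \<le> q x\<close> and \<open>m x \<le> p (- x) + l x\<close>.  The largest
  functional that respects both constraints, and is itself subadditive, is their infimal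
  convolution; the hypothesis says exactly that it is finite, and any linear functional below it
  will do.
\<close>

lemma linear_split_sublinear:
  fixes l p q :: "'v::real_vector \<Rightarrow> real"
  assumes l: "linear l" and p: "sublinear p" and q: "sublinear q"
    and le: "\<And>x. l x \<le> p x + q x"
  obtains m where "linear m" "\<And>x. m x \<le> q x" "\<And>x. l x - m x \<le> p x"
proof -
  define h where "h z x = q z + p (z - x) + l (x - z)" for z x
  define s where "s x = (INF z. h z x)" for x
  have bdd: "bdd_below (range (\<lambda>z. h z x))" for x
  proof (rule bdd_belowI2)
    fix z
    have "p z \<le> p (z - x) + p x" using sublinear_add[OF p, of "z - x" x] by simp
    then show "l x - p x \<le> h z x"
      using le[of z] by (simp add: h_def linear_diff[OF l])
  qed
  have low: "s x \<le> h z x" for z x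
    unfolding s_def using bdd by (intro cINF_lower) auto
  have "sublinear s"
    unfolding s_def
  proof (rule sublinear_INF)
    show "\<exists>k\<in>UNIV. h k (x + y) \<le> h i x + h j y" for i j x y
      using sublinear_add[OF q, of i j] sublinear_add[OF p, of "i - x" "j - y"]
      by (intro bexI[of _ "i + j"]) (auto simp: h_def linear_diff[OF l] linear_add[OF l] algebra_simps)
    show "\<exists>k\<in>UNIV. h k (c *\<^sub>R x) \<le> c * h i x" if "0 < c" for c i x
    proof (rule bexI[of _ "c *\<^sub>R i"])
      have "h (c *\<^sub>R i) (c *\<^sub>R x) = c * h i x"
        unfolding h_def scaleR_diff_right[symmetric] linear_scale[OF l]
        using that by (simp only: sublinear_scale[OF q] sublinear_scale[OF p] less_imp_le
            real_scaleR_def distrib_left)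
      then show "h (c *\<^sub>R i) (c *\<^sub>R x) \<le> c * h i x" by simp
    qed simp
    show "\<exists>i\<in>UNIV. h i 0 \<le> 0"
      by (intro bexI[of _ 0]) (auto simp: h_def sublinear_zero[OF p] sublinear_zero[OF q] linear_0[OF l])
  qed (rule bdd)
  then obtain m where m: "linear m" "\<And>x. m x \<le> s x"
    using linear_below_sublinear by blast
  have "m x \<le> q x" for x
    using m(2)[of x] low[of x x] by (simp add: h_def sublinear_zero[OF p] linear_0[OF l])
  moreover have "l x - m x \<le> p x" for x
    using m(2)[of "- x"] low[of "- x" 0]
    by (simp add: h_def sublinear_zero[OF q] linear_neg[OF l] linear_neg[OF m(1)])
  ultimately show ?thesis using that m(1) by blast
qed

section \<open>Norming functionals on complex normed spaces\<close>

lemma scaleC_Re_Im: "c *\<^sub>C (x::'v::complex_normed_vector) = Re c *\<^sub>R x + Im c *\<^sub>R (\<i> *\<^sub>C x)"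
proof -
  have "c *\<^sub>C x = (complex_of_real (Re c) + complex_of_real (Im c) * \<i>) *\<^sub>C x"
    by (metis complex_eq mult.commute)
  then show ?thesis by (simp add: scaleC_add_left scaleR_scaleC scaleC_scaleC)
qed

text \<open>
  This transfers bounds for the real part of a complex-linear functional to its modulus: a
  rotation of the value is the value at a rotated argument.
\<close>

lemma cmod_le_of_rotations:
  assumes "\<And>u. cmod u = 1 \<Longrightarrow> Re (u * z) \<le> r"
  shows "cmod z \<le> r"
proof (cases "z = 0")
  case True
  then show ?thesis using assms[of 1] by simp
next
  case False
  have "cnj z / cmod z * z = cmod z"
    using False complex_norm_square[of z] by (simp add: power2_eq_square field_simps)
  moreover have "cmod (cnj z / cmod z) = 1" using False by (simp add: norm_divide)
  ultimately show ?thesis using assms[of "cnj z / cmod z"] by simp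
qed

lemma bounded_clinear_add_eq: "bounded_clinear T \<Longrightarrow> T (x + y) = T x + T y"
  and bounded_clinear_diff_eq: "bounded_clinear T \<Longrightarrow> T (x - y) = T x - T y"
  and bounded_clinear_0: "bounded_clinear T \<Longrightarrow> T 0 = 0"
  and bounded_clinear_scaleC_eq: "bounded_clinear T \<Longrightarrow> T (c *\<^sub>C x) = c *\<^sub>C T x"
  and bounded_clinear_scaleR_eq: "bounded_clinear T \<Longrightarrow> T (r *\<^sub>R x) = r *\<^sub>R T x"
  by (auto simp: bounded_clinear_def linear_simps)

lemma cmod_cdual_apply_le: "cmod (cdual_apply \<phi> x) \<le> norm \<phi> * norm x"
  by transfer (simp add: onorm bounded_clinear_bounded_linear)

lemma norm_cdual_le:
  assumes "0 \<le> C" "\<And>x. cmod (cdual_apply \<phi> x) \<le> C * norm x"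
  shows "norm \<phi> \<le> C"
  using assms by transfer (rule onorm_bound)

text \<open>
  The descent of the norm at \<open>y\<close> forces a real-linear functional \<open>l\<close> below it to be at least
  \<open>norm y\<close> at \<open>y\<close>.  The complex-linear functional with real part \<open>l\<close> is
  \<open>x \<mapsto> l x - \<i> l (\<i> x)\<close>, and its norm is controlled by its real part.
\<close>

lemma ex_norming_functional:
  fixes y :: "'b::complex_normed_vector"
  obtains \<phi> where "norm \<phi> \<le> 1" "norm y \<le> cmod (cdual_apply \<phi> y)"
proof -
  obtain p :: "'b \<Rightarrow> real" where p: "sublinear p" "\<And>x. p x \<le> norm x" "p (- y) \<le> - norm y"
    using sublinear_descend[OF sublinear_norm, of y] by blast
  obtain l where l: "linear l" and lp: "\<And>x. l x \<le> p x"
    using linear_below_sublinear[OF p(1)] by blast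
  have l_le: "l x \<le> norm x" for x using lp[of x] p(2)[of x] by linarith
  define g where "g x = Complex (l x) (- l (\<i> *\<^sub>C x))" for x
  have g_add: "g (x + x') = g x + g x'" for x x'
    by (simp add: g_def complex_eq_iff scaleC_add_right linear_add[OF l])
  have g_scaleC: "g (c *\<^sub>C x) = c *\<^sub>C g x" for c x
  proof -
    have *: "l (c *\<^sub>C x) = Re c * l x + Im c * l (\<i> *\<^sub>C x)" for c x
      unfolding scaleC_Re_Im[of c x] by (simp add: linear_add[OF l] linear_scale[OF l])
    have "g (c *\<^sub>C x) = Complex (l (c *\<^sub>C x)) (- l ((\<i> * c) *\<^sub>C x))"
      by (simp only: g_def scaleC_scaleC)
    also have "\<dots> = c *\<^sub>C g x"
      unfolding *[of c] *[of "\<i> * c"]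
      by (simp add: g_def complex_eq_iff scaleC_complex_def)
    finally show ?thesis .
  qed
  have g_le: "cmod (g x) \<le> norm x" for x
  proof (rule cmod_le_of_rotations)
    fix u assume "cmod u = 1"
    have "Re (u * g x) = Re (g (u *\<^sub>C x))"
      by (simp only: g_scaleC scaleC_complex_def)
    also have "\<dots> = l (u *\<^sub>C x)" by (simp add: g_def)
    also have "\<dots> \<le> norm x" using l_le[of "u *\<^sub>C x"] \<open>cmod u = 1\<close> by (simp add: norm_scaleC)
    finally show "Re (u * g x) \<le> norm x" .
  qed
  have "bounded_linear g"
  proof (rule bounded_linear_intro)
    show "g (r *\<^sub>R x) = r *\<^sub>R g x" for r x
      by (simp add: scaleR_scaleC g_scaleC)
    show "norm (g x) \<le> norm x * 1" for x using g_le by simp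
  qed (rule g_add)
  then have g: "bounded_clinear g" by (simp add: bounded_clinear_def g_scaleC)
  then have app: "cdual_apply (Cdual g) = g" by (simp add: Cdual_inverse)
  have "norm (Cdual g) \<le> 1" by (rule norm_cdual_le) (simp_all add: app g_le)
  moreover have "norm y \<le> l y" using lp[of "- y"] p(3) by (simp add: linear_neg[OF l])
  then have "norm y \<le> cmod (g y)" using abs_Re_le_cmod[of "g y"] by (simp add: g_def)
  ultimately show ?thesis using that[of "Cdual g"] app by simp
qed

lemma norm_le_of_functionals:
  fixes y :: "'b::complex_normed_vector"
  assumes "\<And>\<phi>. norm \<phi> \<le> 1 \<Longrightarrow> cmod (cdual_apply \<phi> y) \<le> r"
  shows "norm y \<le> r"
proof -
  obtain \<phi> where "norm \<phi> \<le> 1" "norm y \<le> cmod (cdual_apply \<phi> y)"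
    using ex_norming_functional by blast
  with assms[of \<phi>] show ?thesis by linarith
qed

section \<open>Functionals on the dual that are evaluations\<close>

lemma cdual_apply_plus [simp]: "cdual_apply (\<phi> + \<psi>) x = cdual_apply \<phi> x + cdual_apply \<psi> x"
  and cdual_apply_minus [simp]: "cdual_apply (\<phi> - \<psi>) x = cdual_apply \<phi> x - cdual_apply \<psi> x"
  and cdual_apply_uminus [simp]: "cdual_apply (- \<phi>) x = - cdual_apply \<phi> x"
  and cdual_apply_scaleC [simp]: "cdual_apply (c *\<^sub>C \<phi>) x = c * cdual_apply \<phi> x"
  and cdual_apply_scaleR [simp]: "cdual_apply (r *\<^sub>R \<phi>) x = r *\<^sub>R cdual_apply \<phi> x"
  by (transfer; simp add: scaleC_complex_def)+

lemma cdual_apply_0_right [simp]: "cdual_apply \<phi> 0 = 0"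
  and cdual_apply_add: "cdual_apply \<phi> (x + y) = cdual_apply \<phi> x + cdual_apply \<phi> y"
  and cdual_apply_diff: "cdual_apply \<phi> (x - y) = cdual_apply \<phi> x - cdual_apply \<phi> y"
  and cdual_apply_scaleC_right: "cdual_apply \<phi> (c *\<^sub>C x) = c * cdual_apply \<phi> x"
  and cdual_apply_scaleR_right: "cdual_apply \<phi> (r *\<^sub>R x) = r *\<^sub>R cdual_apply \<phi> x"
  using bounded_clinear_cdual_apply[of \<phi>]
  by (simp_all add: bounded_clinear_0 bounded_clinear_add_eq bounded_clinear_diff_eq
      bounded_clinear_scaleC_eq bounded_clinear_scaleR_eq scaleC_complex_def)

text \<open>
  Such an \<open>l\<close> vanishes on the kernel of the evaluation at \<open>d\<close>, which has complex codimension
  at most one.  So \<open>l\<close> is a real-linear function of the complex number \<open>\<phi> d\<close>, and every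
  real-linear function on the complex plane has the form \<open>z \<mapsto> Re (a z)\<close>.
\<close>

lemma evaluation_of_dominated:
  fixes l :: "'b::complex_normed_vector cdual \<Rightarrow> real"
  assumes l: "linear l" and le: "\<And>\<phi>. l \<phi> \<le> M * cmod (cdual_apply \<phi> d)"
  obtains a where "\<And>\<phi>. l \<phi> = Re (cdual_apply \<phi> (a *\<^sub>C d))"
proof -
  have zero: "l \<phi> = 0" if "cdual_apply \<phi> d = 0" for \<phi>
    using le[of \<phi>] le[of "- \<phi>"] that by (simp add: linear_neg[OF l])
  show ?thesis
  proof (cases "\<exists>\<psi>. cdual_apply \<psi> d \<noteq> 0")
    case False
    then show ?thesis using zero that[of 0] by (simp add: cdual_apply_scaleC_right)
  next
    case True
    then obtain \<psi>' where "cdual_apply \<psi>' d \<noteq> 0" by blast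
    then have "cdual_apply (inverse (cdual_apply \<psi>' d) *\<^sub>C \<psi>') d = 1" by simp
    then obtain \<psi> where \<psi>: "cdual_apply \<psi> d = 1" by blast
    define a where "a = Complex (l \<psi>) (- l (\<i> *\<^sub>C \<psi>))"
    have "l \<phi> = Re (cdual_apply \<phi> (a *\<^sub>C d))" for \<phi>
    proof -
      let ?c = "cdual_apply \<phi> d"
      have "l (\<phi> - ?c *\<^sub>C \<psi>) = 0" by (rule zero) (simp add: \<psi>)
      then have "l \<phi> = l (?c *\<^sub>C \<psi>)" by (simp add: linear_diff[OF l])
      also have "\<dots> = Re ?c * l \<psi> + Im ?c * l (\<i> *\<^sub>C \<psi>)"
        unfolding scaleC_Re_Im[of ?c \<psi>] by (simp add: linear_add[OF l] linear_scale[OF l])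
      also have "\<dots> = Re (cdual_apply \<phi> (a *\<^sub>C d))"
        by (simp add: a_def cdual_apply_scaleC_right)
      finally show ?thesis .
    qed
    then show ?thesis using that by blast
  qed
qed

lemma sublinear_seminorm_at: "0 \<le> M \<Longrightarrow> sublinear (\<lambda>\<phi>. M * cmod (cdual_apply \<phi> d))"
  by (auto simp: sublinear_def distrib_left[symmetric] intro: mult_left_mono norm_triangle_ineq)

text \<open>
  Splitting off one summand at a time leaves a functional dominated by the rest, and the part that
  is split off is an evaluation at a multiple of the point concerned.
\<close>

lemma subtract_evaluations:
  fixes l p :: "'b::complex_normed_vector cdual \<Rightarrow> real"
  assumes "finite F" "0 \<le> M" "sublinear p" "linear l"
    and "\<And>\<phi>. l \<phi> \<le> p \<phi> + (\<Sum>d\<in>F. M * cmod (cdual_apply \<phi> d))"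
  shows "\<exists>y. \<forall>\<phi>. l \<phi> - Re (cdual_apply \<phi> y) \<le> p \<phi>"
  using assms
proof (induction F arbitrary: l rule: finite_induct)
  case empty
  then show ?case by (intro exI[of _ 0]) simp
next
  case (insert d F)
  let ?p = "\<lambda>\<phi>. p \<phi> + (\<Sum>d\<in>F. M * cmod (cdual_apply \<phi> d))"
  have "sublinear ?p"
    unfolding sublinear_def
  proof (intro conjI allI impI)
    fix \<phi> \<psi> :: "'b cdual" and c :: real
    have "(\<Sum>d\<in>F. M * cmod (cdual_apply (\<phi> + \<psi>) d)) \<le>
        (\<Sum>d\<in>F. M * cmod (cdual_apply \<phi> d) + M * cmod (cdual_apply \<psi> d))"
      by (rule sum_mono) (rule sublinear_add[OF sublinear_seminorm_at[OF insert.prems(1)]])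
    then show "?p (\<phi> + \<psi>) \<le> ?p \<phi> + ?p \<psi>"
      using sublinear_add[OF insert.prems(2), of \<phi> \<psi>] by (simp add: sum.distrib)
    show "?p (c *\<^sub>R \<phi>) = c * ?p \<phi>" if "0 \<le> c"
      using that sublinear_scale[OF insert.prems(2) that]
      by (simp add: distrib_left sum_distrib_left mult.left_commute)
  qed
  moreover have "l \<phi> \<le> ?p \<phi> + M * cmod (cdual_apply \<phi> d)" for \<phi>
    using insert.prems(4)[of \<phi>] insert.hyps by simp
  ultimately obtain m where m: "linear m" "\<And>\<phi>. m \<phi> \<le> M * cmod (cdual_apply \<phi> d)"
      "\<And>\<phi>. l \<phi> - m \<phi> \<le> ?p \<phi>"
    using linear_split_sublinear[OF insert.prems(3) _ sublinear_seminorm_at[OF insert.prems(1)],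
        of ?p d thesis] by blast
  obtain a where a: "\<And>\<phi>. m \<phi> = Re (cdual_apply \<phi> (a *\<^sub>C d))"
    using evaluation_of_dominated[OF m(1,2)] by blast
  have "\<exists>y. \<forall>\<phi>. (l \<phi> - m \<phi>) - Re (cdual_apply \<phi> y) \<le> p \<phi>"
    using insert.prems(1,2) linear_compose_sub[OF insert.prems(3) m(1)] m(3)
    by (rule insert.IH)
  then obtain y where "\<And>\<phi>. (l \<phi> - m \<phi>) - Re (cdual_apply \<phi> y) \<le> p \<phi>" by blast
  then show ?case
    by (intro exI[of _ "a *\<^sub>C d + y"]) (simp add: a cdual_apply_add algebra_simps)
qed

section \<open>Compactness and finite nets\<close>

lemma totally_bounded_of_compact_closure:
  fixes D :: "'b::metric_space set"
  assumes "compact (closure D)" "0 < e"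
  obtains F where "finite F" "F \<subseteq> D" "\<And>d. d \<in> D \<Longrightarrow> \<exists>k\<in>F. dist k d < e"
proof -
  have cover: "closure D \<subseteq> (\<Union>k\<in>D. ball k e)"
    using assms(2) by (force simp: closure_approachable)
  obtain F where "F \<subseteq> D" "finite F" "closure D \<subseteq> (\<Union>k\<in>F. ball k e)"
    using compactE_image[OF assms(1) open_ball cover] by blast
  then have "\<exists>k\<in>F. dist k d < e" if "d \<in> D" for d
    using closure_subset[of D] that by (auto simp: subset_iff)
  with \<open>finite F\<close> \<open>F \<subseteq> D\<close> show ?thesis by (rule that)
qed

text \<open>
  Total boundedness is stated in terms of sets of small diameter because covers of this kind are
  easy to refine, which is how \<open>finite_cover_small_oscillation\<close> builds them.
\<close>

lemma compact_closure_of_small_covers: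
  fixes D :: "'b::complete_space set"
  assumes "\<And>e. 0 < e \<Longrightarrow> \<exists>\<C>. finite \<C> \<and> D \<subseteq> \<Union>\<C> \<and> (\<forall>A\<in>\<C>. \<forall>x\<in>A. \<forall>y\<in>A. dist x y \<le> e)"
  shows "compact (closure D)"
  unfolding compact_eq_totally_bounded
proof (intro conjI allI impI)
  show "complete (closure D)" by (simp add: complete_eq_closed)
  fix e :: real assume "0 < e"
  then obtain \<C> where \<C>: "finite \<C>" "D \<subseteq> \<Union>\<C>"
      "\<And>A x y. A \<in> \<C> \<Longrightarrow> x \<in> A \<Longrightarrow> y \<in> A \<Longrightarrow> dist x y \<le> e / 2"
    using assms[of "e / 2"] by (auto; blast)
  let ?k = "(\<lambda>A. SOME x. x \<in> A) ` \<C>"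
  have "D \<subseteq> (\<Union>x\<in>?k. cball x (e / 2))"
  proof
    fix d assume "d \<in> D"
    then obtain A where "A \<in> \<C>" "d \<in> A" using \<C>(2) by blast
    then have "(SOME x. x \<in> A) \<in> A" by (auto intro: someI)
    then show "d \<in> (\<Union>x\<in>?k. cball x (e / 2))"
      using \<C>(3)[OF \<open>A \<in> \<C>\<close> _ \<open>d \<in> A\<close>] \<open>A \<in> \<C>\<close> by auto
  qed
  moreover have "closed (\<Union>x\<in>?k. cball x (e / 2))" using \<C>(1) by (intro closed_UN) auto
  ultimately have "closure D \<subseteq> (\<Union>x\<in>?k. cball x (e / 2))" by (rule closure_minimal)
  also have "\<dots> \<subseteq> (\<Union>x\<in>?k. ball x e)" using \<open>0 < e\<close> by auto
  finally show "\<exists>k. finite k \<and> closure D \<subseteq> (\<Union>x\<in>k. ball x e)" using \<C>(1) by blast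
qed

section \<open>Functionals dominated on a relatively compact set\<close>

text \<open>
  A finite net \<open>F\<close> of \<open>D\<close> turns the hypothesis
  into \<open>cmod (\<Lambda> \<phi>) \<le> e * norm \<phi> + (\<Sum>d\<in>F. C * cmod (\<phi> d))\<close>, and after subtracting a suitable
  evaluation only the first summand remains.  Hence \<open>\<Lambda>\<close> is a norm limit of evaluations.  The
  embedding of the space into its bidual is isometric, so the points of evaluation form a
  Cauchy sequence; its limit represents \<open>\<Lambda>\<close>.
\<close>

lemma evaluation_of_compactly_dominated:
  fixes \<Lambda> :: "'b::{complex_normed_vector,banach} cdual \<Rightarrow> complex"
  assumes \<Lambda>: "bounded_clinear \<Lambda>" and D: "compact (closure D)" and "0 \<le> C"
    and le: "\<And>\<phi> r. 0 \<le> r \<Longrightarrow> (\<And>d. d \<in> D \<Longrightarrow> cmod (cdual_apply \<phi> d) \<le> r) \<Longrightarrow> cmod (\<Lambda> \<phi>) \<le> C * r"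
  obtains y where "\<And>\<phi>. \<Lambda> \<phi> = cdual_apply \<phi> y"
proof -
  have approx: "\<exists>y. \<forall>\<phi>. cmod (\<Lambda> \<phi> - cdual_apply \<phi> y) \<le> e * norm \<phi>" if "0 < e" for e
  proof -
    \<comment> \<open>The denominator is \<open>C + 1\<close> because \<open>C\<close> may be zero.\<close>
    define \<delta> where "\<delta> = e / (C + 1)"
    have \<delta>: "0 < \<delta>" "C * \<delta> \<le> e" using that \<open>0 \<le> C\<close> by (auto simp: \<delta>_def field_simps)
    obtain F where F: "finite F" "\<And>d. d \<in> D \<Longrightarrow> \<exists>k\<in>F. dist k d < \<delta>"
      using totally_bounded_of_compact_closure[OF D \<delta>(1)] by metis
    have dom: "cmod (\<Lambda> \<phi>) \<le> e * norm \<phi> + (\<Sum>d\<in>F. C * cmod (cdual_apply \<phi> d))" for \<phi>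
    proof -
      let ?r = "\<delta> * norm \<phi> + (\<Sum>d\<in>F. cmod (cdual_apply \<phi> d))"
      have "cmod (\<Lambda> \<phi>) \<le> C * ?r"
      proof (rule le)
        show "0 \<le> ?r" using \<delta>(1) by (simp add: sum_nonneg)
        fix d assume "d \<in> D"
        then obtain k where k: "k \<in> F" "dist k d < \<delta>" using F(2) by blast
        have "cmod (cdual_apply \<phi> d) \<le> cmod (cdual_apply \<phi> (d - k)) + cmod (cdual_apply \<phi> k)"
          using norm_triangle_ineq[of "cdual_apply \<phi> (d - k)" "cdual_apply \<phi> k"]
          by (simp add: cdual_apply_diff)
        also have "cmod (cdual_apply \<phi> (d - k)) \<le> norm \<phi> * norm (d - k)"
          by (rule cmod_cdual_apply_le)
        also have "\<dots> \<le> norm \<phi> * \<delta>"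
          using k(2) by (intro mult_left_mono) (auto simp: dist_norm norm_minus_commute)
        also have "cmod (cdual_apply \<phi> k) \<le> (\<Sum>d\<in>F. cmod (cdual_apply \<phi> d))"
          using k(1) F(1) by (intro member_le_sum) auto
        finally show "cmod (cdual_apply \<phi> d) \<le> ?r" by (simp add: mult.commute)
      qed
      also have "\<dots> = (C * \<delta>) * norm \<phi> + (\<Sum>d\<in>F. C * cmod (cdual_apply \<phi> d))"
        by (simp add: distrib_left sum_distrib_left)
      also have "(C * \<delta>) * norm \<phi> \<le> e * norm \<phi>" using \<delta>(2) by (intro mult_right_mono) auto
      finally show ?thesis by simp
    qed
    have "sublinear (\<lambda>\<phi>::'b cdual. e * norm \<phi>)"
      using that by (auto simp: sublinear_def distrib_left[symmetric] norm_triangle_ineq)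
    moreover have "linear (\<lambda>\<phi>. Re (\<Lambda> \<phi>))"
      by (rule linearI) (auto simp: bounded_clinear_add_eq[OF \<Lambda>] bounded_clinear_scaleR_eq[OF \<Lambda>])
    moreover have "Re (\<Lambda> \<phi>) \<le> e * norm \<phi> + (\<Sum>d\<in>F. C * cmod (cdual_apply \<phi> d))" for \<phi>
      using dom[of \<phi>] complex_Re_le_cmod[of "\<Lambda> \<phi>"] by linarith
    ultimately obtain y where y: "\<And>\<phi>. Re (\<Lambda> \<phi>) - Re (cdual_apply \<phi> y) \<le> e * norm \<phi>"
      using subtract_evaluations[OF F(1) \<open>0 \<le> C\<close>] by blast
    have "cmod (\<Lambda> \<phi> - cdual_apply \<phi> y) \<le> e * norm \<phi>" for \<phi>
    proof (rule cmod_le_of_rotations)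
      fix u assume "cmod u = 1"
      have "Re (u * (\<Lambda> \<phi> - cdual_apply \<phi> y)) = Re (\<Lambda> (u *\<^sub>C \<phi>)) - Re (cdual_apply (u *\<^sub>C \<phi>) y)"
        unfolding bounded_clinear_scaleC_eq[OF \<Lambda>] by (simp add: scaleC_complex_def algebra_simps)
      also have "\<dots> \<le> e * norm \<phi>" using y[of "u *\<^sub>C \<phi>"] \<open>cmod u = 1\<close> by (simp add: norm_scaleC)
      finally show "Re (u * (\<Lambda> \<phi> - cdual_apply \<phi> y)) \<le> e * norm \<phi>" .
    qed
    then show ?thesis by blast
  qed
  define \<epsilon> :: "nat \<Rightarrow> real" where "\<epsilon> n = inverse (Suc n)" for n
  have \<epsilon>_pos: "0 < \<epsilon> n" for n by (simp add: \<epsilon>_def)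
  have \<epsilon>_lim: "\<epsilon> \<longlonglongrightarrow> 0" unfolding \<epsilon>_def by (rule LIMSEQ_inverse_real_of_nat)
  obtain y where y: "\<And>n \<phi>. cmod (\<Lambda> \<phi> - cdual_apply \<phi> (y n)) \<le> \<epsilon> n * norm \<phi>"
    using approx[OF \<epsilon>_pos] by metis
  have "norm (y m - y n) \<le> \<epsilon> m + \<epsilon> n" for m n
  proof (rule norm_le_of_functionals)
    fix \<phi> :: "'b cdual" assume \<phi>: "norm \<phi> \<le> 1"
    have "cmod (cdual_apply \<phi> (y m - y n)) \<le> \<epsilon> m * norm \<phi> + \<epsilon> n * norm \<phi>"
      using y[of \<phi> m] y[of \<phi> n]
        norm_triangle_ineq4[of "\<Lambda> \<phi> - cdual_apply \<phi> (y n)" "\<Lambda> \<phi> - cdual_apply \<phi> (y m)"]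
      by (simp add: cdual_apply_diff)
    also have "\<dots> \<le> \<epsilon> m + \<epsilon> n"
      using \<phi> \<epsilon>_pos[of m] \<epsilon>_pos[of n] by (intro add_mono mult_left_le) auto
    finally show "cmod (cdual_apply \<phi> (y m - y n)) \<le> \<epsilon> m + \<epsilon> n" .
  qed
  moreover have "\<exists>N. \<forall>m\<ge>N. \<forall>n\<ge>N. \<epsilon> m + \<epsilon> n < r" if "0 < r" for r
  proof -
    have "\<forall>\<^sub>F n in sequentially. \<epsilon> n < r / 2"
      using \<epsilon>_lim that by (intro order_tendstoD(2)) auto
    then obtain N where N: "\<forall>n\<ge>N. \<epsilon> n < r / 2" unfolding eventually_sequentially by blast
    have "\<epsilon> m + \<epsilon> n < r" if "N \<le> m" "N \<le> n" for m n
      using N[rule_format, OF that(1)] N[rule_format, OF that(2)] by linarith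
    then show ?thesis by blast
  qed
  ultimately have "Cauchy y"
    unfolding Cauchy_def dist_norm by (meson le_less_trans)
  then obtain z where z: "y \<longlonglongrightarrow> z" using Cauchy_convergent_iff convergent_def by blast
  have "\<Lambda> \<phi> = cdual_apply \<phi> z" for \<phi>
  proof -
    have "(\<lambda>n. cdual_apply \<phi> (y n)) \<longlonglongrightarrow> cdual_apply \<phi> z"
      using bounded_clinear_bounded_linear[OF bounded_clinear_cdual_apply] z
      by (rule bounded_linear.tendsto)
    moreover have "(\<lambda>n. \<Lambda> \<phi> - cdual_apply \<phi> (y n)) \<longlonglongrightarrow> 0"
    proof (rule Lim_null_comparison)
      show "\<forall>\<^sub>F n in sequentially. cmod (\<Lambda> \<phi> - cdual_apply \<phi> (y n)) \<le> \<epsilon> n * norm \<phi>"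
        using y by simp
      show "(\<lambda>n. \<epsilon> n * norm \<phi>) \<longlonglongrightarrow> 0" using tendsto_mult_right[OF \<epsilon>_lim, of "norm \<phi>"] by simp
    qed
    then have "(\<lambda>n. cdual_apply \<phi> (y n)) \<longlonglongrightarrow> \<Lambda> \<phi>"
      using tendsto_diff[OF tendsto_const[of "\<Lambda> \<phi>"]] by fastforce
    ultimately show ?thesis using LIMSEQ_unique by blast
  qed
  then show ?thesis using that by blast
qed

section \<open>The Banach-Alaoglu theorem\<close>

lemma openin_weak_star_evaluation: "open U \<Longrightarrow> openin weak_star_topology {\<phi>. cdual_apply \<phi> x \<in> U}"
  unfolding weak_star_topology_def by (rule topology_generated_by_Basis) blast

text \<open>
  Identify functionals with functions on the space.  Those of norm at most \<open>r\<close> form a set \<open>K\<close>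
  that is closed in a product of closed discs, hence compact by Tychonoff's theorem, and the
  identification is continuous from \<open>K\<close> to the weak* topology because both topologies are
  generated by evaluations.
\<close>

lemma compactin_weak_star_cball:
  "compactin weak_star_topology (cball 0 r :: 'b::complex_normed_vector cdual set)"
proof (cases "0 \<le> r")
  case False
  then show ?thesis by simp
next
  case True
  define K where "K = {g :: 'b \<Rightarrow> complex. (\<forall>x y. g (x + y) = g x + g y) \<and>
    (\<forall>c x. g (c *\<^sub>C x) = c * g x) \<and> (\<forall>x. g x \<in> cball 0 (r * norm x))}"
  let ?P = "PiE UNIV (\<lambda>x. cball 0 (r * norm x)) :: ('b \<Rightarrow> complex) set"
  have "compactin (product_topology (\<lambda>_. euclidean) UNIV) ?P"
    by (simp add: compactin_PiE)
  then have "compact ?P" by (simp add: euclidean_product_topology)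
  moreover have "closed {g :: 'b \<Rightarrow> complex. (\<forall>x y. g (x + y) = g x + g y) \<and>
      (\<forall>c x. g (c *\<^sub>C x) = c * g x)}"
    by (intro closed_Collect_conj closed_Collect_all closed_Collect_eq continuous_intros
        continuous_on_product_coordinates)
  moreover have "K = ?P \<inter> {g. (\<forall>x y. g (x + y) = g x + g y) \<and> (\<forall>c x. g (c *\<^sub>C x) = c * g x)}"
    by (auto simp: K_def PiE_def)
  ultimately have "compact K" by (simp add: compact_Int_closed)
  have Cdual: "cdual_apply (Cdual g) = g" "norm (Cdual g) \<le> r" if "g \<in> K" for g
  proof -
    have g: "g (x + y) = g x + g y" "g (c *\<^sub>C x) = c * g x" "cmod (g x) \<le> r * norm x" for x y c
      using that by (auto simp: K_def)
    have "bounded_linear g"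
      by (rule bounded_linear_intro[of _ r])
        (auto simp: g scaleR_scaleC scaleC_complex_def mult.commute[of _ r])
    then have "bounded_clinear g" by (simp add: bounded_clinear_def g scaleC_complex_def)
    then show *: "cdual_apply (Cdual g) = g" by (simp add: Cdual_inverse)
    show "norm (Cdual g) \<le> r" using True by (rule norm_cdual_le) (simp add: * g)
  qed
  have image: "cball 0 r \<subseteq> Cdual ` K"
  proof
    fix \<phi> :: "'b cdual" assume "\<phi> \<in> cball 0 r"
    then have "cmod (cdual_apply \<phi> x) \<le> r * norm x" for x
      using cmod_cdual_apply_le[of \<phi> x] mult_right_mono[of "norm \<phi>" r "norm x"] by simp
    then have "cdual_apply \<phi> \<in> K"
      by (simp add: K_def cdual_apply_add cdual_apply_scaleC_right)
    then show "\<phi> \<in> Cdual ` K" by (metis cdual_apply_inverse imageI)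
  qed
  have cont: "continuous_map (subtopology euclidean K) weak_star_topology Cdual"
    unfolding weak_star_topology_def continuous_on_generated_topo_iff
  proof (intro conjI allI impI)
    fix V :: "'b cdual set" assume "V \<in> {{\<phi>. cdual_apply \<phi> x \<in> U} | x U. open U}"
    then obtain x U where V: "V = {\<phi>. cdual_apply \<phi> x \<in> U}" "open U" by blast
    have "open ((\<lambda>g::'b \<Rightarrow> complex. g x) -` U)"
      using V(2) continuous_on_product_coordinates by (rule open_vimage)
    moreover have "Cdual -` V \<inter> K = K \<inter> (\<lambda>g. g x) -` U" using V(1) Cdual(1) by auto
    ultimately show "openin (top_of_set K) (Cdual -` V \<inter> topspace (top_of_set K))"
      by (simp add: openin_open_Int)
  next
    have "UNIV \<in> {{\<phi>::'b cdual. cdual_apply \<phi> x \<in> U} | x U. open U}"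
      by (intro CollectI exI[of _ 0] exI[of _ UNIV]) simp
    then show "Cdual ` topspace (top_of_set K) \<subseteq> \<Union>{{\<phi>. cdual_apply \<phi> x \<in> U} | x U. open U}"
      by blast
  qed
  have "compactin (top_of_set K) K" using \<open>compact K\<close> by simp
  then have "compactin weak_star_topology (Cdual ` K)" using cont by (rule image_compactin)
  moreover have "Cdual ` K = cball 0 r" using image Cdual(2) by auto
  ultimately show ?thesis by simp
qed

section \<open>The transpose and the Lipschitz image\<close>

lemma norm_hol_lip_le:
  assumes "0 \<le> C" "\<And>x y. x \<in> ball 0 1 \<Longrightarrow> y \<in> ball 0 1 \<Longrightarrow>
    norm (hol_lip_apply g x - hol_lip_apply g y) \<le> C * norm (x - y)"
  shows "norm g \<le> C"
  using assms by transfer (rule lip_norm_le)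

lemma norm_hol_lip_diff_le:
  assumes "x \<in> ball 0 1" "y \<in> ball 0 1"
  shows "norm (hol_lip_apply g x - hol_lip_apply g y) \<le> norm g * norm (x - y)"
  using assms by transfer (auto intro: lip_norm_bound)

lemma hol_lip_apply_transpose:
  "hol_lip_apply (hol_lip_transpose f \<phi>) x = cdual_apply \<phi> (hol_lip_apply f x)"
  by transfer simp

lemma norm_divideR_le_iff:
  "0 < n \<Longrightarrow> norm (v /\<^sub>R n) \<le> C \<longleftrightarrow> norm v \<le> C * n"
  by (simp add: field_simps)

text \<open>
  The norm of the transpose at \<open>\<phi>\<close> is the supremum of \<open>\<phi>\<close> in modulus over the Lipschitz image.
  This and \<open>cmod_le_norm_transpose\<close> are the two halves of that identity.
\<close>

lemma norm_transpose_le: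
  fixes f :: "('a::complex_normed_vector, 'b::complex_normed_vector) hol_lip"
  assumes "0 \<le> r" "\<And>d. d \<in> lipschitz_image f \<Longrightarrow> cmod (cdual_apply \<phi> d) \<le> r"
  shows "norm (hol_lip_transpose f \<phi>) \<le> r"
proof (rule norm_hol_lip_le[OF assms(1)])
  fix x y :: 'a assume xy: "x \<in> ball 0 1" "y \<in> ball 0 1"
  show "cmod (hol_lip_apply (hol_lip_transpose f \<phi>) x - hol_lip_apply (hol_lip_transpose f \<phi>) y)
      \<le> r * norm (x - y)"
  proof (cases "x = y")
    case False
    let ?d = "(hol_lip_apply f x - hol_lip_apply f y) /\<^sub>R norm (x - y)"
    have "?d \<in> lipschitz_image f" using xy False by (auto simp: lipschitz_image_def)
    then have "cmod (cdual_apply \<phi> ?d) \<le> r" by (rule assms(2))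
    then show ?thesis
      using False
      by (simp only: hol_lip_apply_transpose cdual_apply_scaleR_right cdual_apply_diff
          norm_divideR_le_iff zero_less_norm_iff right_minus_eq not_False_eq_True)
  qed simp
qed

lemma cmod_le_norm_transpose:
  assumes "d \<in> lipschitz_image f"
  shows "cmod (cdual_apply \<phi> d) \<le> norm (hol_lip_transpose f \<phi>)"
proof -
  obtain x y where d: "d = (hol_lip_apply f x - hol_lip_apply f y) /\<^sub>R norm (x - y)"
      and xy: "x \<in> ball 0 1" "y \<in> ball 0 1" "x \<noteq> y"
    using assms by (auto simp: lipschitz_image_def)
  show ?thesis
    using norm_hol_lip_diff_le[OF xy(1,2), of "hol_lip_transpose f \<phi>"] xy(3)
    by (simp only: d hol_lip_apply_transpose cdual_apply_scaleR_right cdual_apply_diff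
        norm_divideR_le_iff zero_less_norm_iff right_minus_eq not_False_eq_True)
qed

lemma norm_lipschitz_image_le:
  assumes "d \<in> lipschitz_image f"
  shows "norm d \<le> norm f"
proof -
  obtain x y where d: "d = (hol_lip_apply f x - hol_lip_apply f y) /\<^sub>R norm (x - y)"
      and xy: "x \<in> ball 0 1" "y \<in> ball 0 1" "x \<noteq> y"
    using assms by (auto simp: lipschitz_image_def)
  show ?thesis
    using norm_hol_lip_diff_le[OF xy(1,2), of f] xy(3)
    by (simp only: d norm_divideR_le_iff zero_less_norm_iff right_minus_eq not_False_eq_True)
qed

lemma bounded_clinear_transpose: "bounded_clinear (hol_lip_transpose f)"
proof -
  have add: "hol_lip_transpose f (\<phi> + \<psi>) = hol_lip_transpose f \<phi> + hol_lip_transpose f \<psi>" for \<phi> \<psi>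
    by transfer simp
  have scaleC: "hol_lip_transpose f (c *\<^sub>C \<phi>) = c *\<^sub>C hol_lip_transpose f \<phi>" for c \<phi>
    by transfer simp
  have "bounded_linear (hol_lip_transpose f)"
  proof (rule bounded_linear_intro)
    fix \<phi>
    show "norm (hol_lip_transpose f \<phi>) \<le> norm \<phi> * norm f"
    proof (rule norm_transpose_le)
      fix d assume "d \<in> lipschitz_image f"
      then show "cmod (cdual_apply \<phi> d) \<le> norm \<phi> * norm f"
        using cmod_cdual_apply_le[of \<phi> d] norm_lipschitz_image_le[of d f]
          mult_left_mono[of "norm d" "norm f" "norm \<phi>"] by simp
    qed simp
  qed (simp_all add: add scaleC scaleR_scaleC)
  then show ?thesis by (simp add: bounded_clinear_def scaleC)
qed

section \<open>Compactness and continuity of the transpose\<close>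

lemma topspace_bounded_weak_star [simp]: "topspace bounded_weak_star_topology = UNIV"
  and subtopology_bounded_weak_star:
    "bounded B \<Longrightarrow> subtopology bounded_weak_star_topology B = subtopology weak_star_topology B"
  using agrees_bounded_weak_star_topology unfolding agrees_weak_star_on_bounded_def by blast+

text \<open>
  On a bounded set of functionals, closeness on a finite net of the Lipschitz image gives
  closeness on all of it, that is, closeness of the transposes in norm.
\<close>

lemma compact_imp_bounded_weak_star_continuous:
  fixes f :: "('a::complex_normed_vector, 'b::complex_normed_vector) hol_lip"
  assumes "compact_hol_lip f"
  shows "continuous_map bounded_weak_star_topology euclidean (hol_lip_transpose f)"
proof -
  let ?T = "hol_lip_transpose f" and ?D = "lipschitz_image f"
  have "openin (subtopology weak_star_topology B) (?T -` U \<inter> B)" if "open U" "bounded B" for U B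
    unfolding openin_subopen[of _ "?T -` U \<inter> B"]
  proof
    fix \<phi>0 assume \<phi>0: "\<phi>0 \<in> ?T -` U \<inter> B"
    then obtain e where e: "0 < e" "ball (?T \<phi>0) e \<subseteq> U"
      using \<open>open U\<close> by (auto simp: open_contains_ball)
    \<comment> \<open>Two functionals in \<open>B\<close> are at most \<open>2 * M\<close> apart, so a mesh of \<open>e / (4 * M)\<close>
      costs at most \<open>e / 2\<close>, and \<open>e / 4\<close> is left for the points of the net.\<close>
    obtain M where M: "0 < M" "\<And>\<phi>. \<phi> \<in> B \<Longrightarrow> norm \<phi> \<le> M"
      using \<open>bounded B\<close> by (auto simp: bounded_pos)
    have "compact (closure ?D)" using assms by (simp add: compact_hol_lip_def)
    then obtain F where F: "finite F" "\<And>d. d \<in> ?D \<Longrightarrow> \<exists>k\<in>F. dist k d < e / (4 * M)"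
      using e(1) M(1) totally_bounded_of_compact_closure[of ?D "e / (4 * M)"]
      by (metis zero_less_divide_iff zero_less_mult_iff zero_less_numeral)
    define W where "W = (\<Inter>k\<in>F. {\<phi>. cdual_apply \<phi> k \<in> ball (cdual_apply \<phi>0 k) (e / 4)})"
    have "openin weak_star_topology (W \<inter> topspace weak_star_topology)"
      unfolding W_def using F(1) by (intro openin_INT openin_weak_star_evaluation) auto
    then have "openin (subtopology weak_star_topology B) (W \<inter> B)"
      by (simp add: openin_subtopology_Int)
    moreover have "\<phi>0 \<in> W \<inter> B" using \<phi>0 e(1) by (simp add: W_def)
    moreover have "W \<inter> B \<subseteq> ?T -` U \<inter> B"
    proof
      fix \<phi> assume \<phi>: "\<phi> \<in> W \<inter> B"
      have "norm (?T (\<phi>0 - \<phi>)) \<le> 3 * e / 4"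
      proof (rule norm_transpose_le)
        fix d assume "d \<in> ?D"
        then obtain k where k: "k \<in> F" "dist k d < e / (4 * M)" using F(2) by blast
        have "norm (\<phi>0 - \<phi>) \<le> M + M"
          using norm_triangle_ineq4[of \<phi>0 \<phi>] M(2)[of \<phi>0] M(2)[of \<phi>] \<phi> \<phi>0 by simp
        then have "norm (\<phi>0 - \<phi>) * norm (d - k) \<le> (M + M) * (e / (4 * M))"
          using k(2) M(1) by (intro mult_mono) (auto simp: dist_norm norm_minus_commute)
        also have "\<dots> = e / 2" using M(1) by (simp add: field_simps)
        finally have "cmod (cdual_apply (\<phi>0 - \<phi>) (d - k)) \<le> e / 2"
          using cmod_cdual_apply_le[of "\<phi>0 - \<phi>" "d - k"] by linarith
        moreover have "cmod (cdual_apply (\<phi>0 - \<phi>) k) < e / 4"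
          using \<phi> k(1) by (auto simp: W_def dist_norm)
        ultimately show "cmod (cdual_apply (\<phi>0 - \<phi>) d) \<le> 3 * e / 4"
          using norm_triangle_ineq[of "cdual_apply (\<phi>0 - \<phi>) (d - k)" "cdual_apply (\<phi>0 - \<phi>) k"]
          unfolding cdual_apply_add[symmetric] by simp
      qed (use e(1) in simp)
      then have "?T \<phi> \<in> ball (?T \<phi>0) e"
        using e(1) by (simp add: dist_norm bounded_clinear_diff_eq[OF bounded_clinear_transpose])
      then show "\<phi> \<in> ?T -` U \<inter> B" using e(2) \<phi> by blast
    qed
    ultimately show "\<exists>V. openin (subtopology weak_star_topology B) V \<and> \<phi>0 \<in> V \<and>
        V \<subseteq> ?T -` U \<inter> B" by blast
  qed
  then have "openin bounded_weak_star_topology (?T -` U)" if "open U" for U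
    using that by (simp add: openin_bounded_weak_star_topology)
  then show ?thesis by (simp add: continuous_map_alt)
qed

text \<open>
  The closed unit ball is weak* compact, and the two topologies agree on it.  So its image is
  compact, and therefore closed, and contains the closure of the image of the open ball.
\<close>

lemma bounded_weak_star_continuous_imp_compact_operator:
  fixes T :: "'b::complex_normed_vector cdual \<Rightarrow> 'c::complex_normed_vector"
  assumes "bounded_clinear T" "continuous_map bounded_weak_star_topology euclidean T"
  shows "compact_operator T"
proof -
  let ?B = "cball 0 1 :: 'b cdual set"
  have "subtopology bounded_weak_star_topology ?B = subtopology weak_star_topology ?B"
    by (rule subtopology_bounded_weak_star) simp
  then have "compactin (subtopology bounded_weak_star_topology ?B) ?B"
    by (simp add: compactin_weak_star_cball)
  then have "compactin euclidean (T ` ?B)"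
    using continuous_map_from_subtopology[OF assms(2)] by (rule image_compactin)
  then have K: "compact (T ` ?B)" by simp
  have "closure (T ` ball 0 1) \<subseteq> T ` ?B"
    using compact_imp_closed[OF K] by (intro closure_minimal image_mono) auto
  then have "compact (closure (T ` ball 0 1))"
    using K by (metis closed_closure compact_Int_closed inf.absorb2)
  with assms(1) show ?thesis by (simp add: compact_operator_def)
qed

lemma finite_cover_small_oscillation:
  fixes h :: "'i \<Rightarrow> 'd \<Rightarrow> 'c::heine_borel"
  assumes "finite I" "\<And>i. i \<in> I \<Longrightarrow> bounded (h i ` D)" "0 < e"
  shows "\<exists>\<C>. finite \<C> \<and> D \<subseteq> \<Union>\<C> \<and> (\<forall>A\<in>\<C>. A \<subseteq> D \<and> (\<forall>i\<in>I. \<forall>x\<in>A. \<forall>y\<in>A. dist (h i x) (h i y) < e))"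
  using assms(1,2)
proof (induction I rule: finite_induct)
  case empty
  then show ?case by (intro exI[of _ "{D}"]) auto
next
  case (insert i I)
  have "\<And>j. j \<in> I \<Longrightarrow> bounded (h j ` D)" using insert.prems by simp
  then have "\<exists>\<C>. finite \<C> \<and> D \<subseteq> \<Union>\<C> \<and>
      (\<forall>A\<in>\<C>. A \<subseteq> D \<and> (\<forall>j\<in>I. \<forall>x\<in>A. \<forall>y\<in>A. dist (h j x) (h j y) < e))"
    by (rule insert.IH)
  then obtain \<C> where \<C>: "finite \<C>" "D \<subseteq> \<Union>\<C>" and
    small: "\<forall>A\<in>\<C>. A \<subseteq> D \<and> (\<forall>j\<in>I. \<forall>x\<in>A. \<forall>y\<in>A. dist (h j x) (h j y) < e)"
    by (elim exE conjE)
  have "compact (closure (h i ` D))" using insert.prems by (simp add: compact_closure)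
  then obtain N where N: "finite N" "\<And>z. z \<in> h i ` D \<Longrightarrow> \<exists>k\<in>N. dist k z < e / 2"
    using totally_bounded_of_compact_closure[of "h i ` D" "e / 2"] \<open>0 < e\<close> by (metis half_gt_zero)
  let ?C = "(\<lambda>(A, k). A \<inter> h i -` ball k (e / 2)) ` (\<C> \<times> N)"
  have "finite ?C" using \<C>(1) N(1) by simp
  moreover have "D \<subseteq> \<Union>?C"
  proof
    fix x assume x: "x \<in> D"
    then obtain A where A: "A \<in> \<C>" "x \<in> A" using \<C>(2) by blast
    obtain k where k: "k \<in> N" "dist k (h i x) < e / 2" using N(2) x by blast
    show "x \<in> \<Union>?C" using A k by (intro UnionI[OF imageI[of "(A, k)"]]) auto
  qed
  moreover have "\<forall>B\<in>?C. B \<subseteq> D \<and> (\<forall>j\<in>insert i I. \<forall>x\<in>B. \<forall>y\<in>B. dist (h j x) (h j y) < e)"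
  proof
    fix B assume "B \<in> ?C"
    then obtain A k where B: "A \<in> \<C>" "B = A \<inter> h i -` ball k (e / 2)" by auto
    have "dist (h i x) (h i y) < e" if "x \<in> B" "y \<in> B" for x y
      using that dist_triangle_half_r[of k "h i x" e "h i y"] by (auto simp: B(2))
    then show "B \<subseteq> D \<and> (\<forall>j\<in>insert i I. \<forall>x\<in>B. \<forall>y\<in>B. dist (h j x) (h j y) < e)"
      using bspec[OF small B(1)] by (auto simp: B(2))
  qed
  ultimately show ?case by (intro exI[of _ ?C] conjI)
qed

text \<open>
  This is the argument of Schauder's theorem.  A finite net of the image of the dual unit ball
  comes from finitely many functionals \<open>\<Phi>\<close>.  Where all of \<open>\<Phi>\<close> oscillate little, every functional in
  the dual unit ball does, so by norming functionals the points there are close to each other.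
\<close>

lemma compact_transpose_imp_compact:
  fixes f :: "('a::complex_normed_vector, 'b::{complex_normed_vector,banach}) hol_lip"
  assumes "compact_operator (hol_lip_transpose f)"
  shows "compact_hol_lip f"
  unfolding compact_hol_lip_def
proof (rule compact_closure_of_small_covers)
  let ?T = "hol_lip_transpose f" and ?D = "lipschitz_image f"
  fix e :: real assume "0 < e"
  have "compact (closure (?T ` ball 0 1))" using assms by (simp add: compact_operator_def)
  moreover have e4: "0 < e / 4" using \<open>0 < e\<close> by simp
  ultimately obtain G where G: "finite G" "G \<subseteq> ?T ` ball 0 1"
      "\<And>g. g \<in> ?T ` ball 0 1 \<Longrightarrow> \<exists>k\<in>G. dist k g < e / 4"
    using totally_bounded_of_compact_closure by metis
  obtain \<Phi> where \<Phi>: "finite \<Phi>" "G = ?T ` \<Phi>" using finite_subset_image[OF G(1,2)] by blast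
  have "bounded (cdual_apply \<phi> ` ?D)" for \<phi>
    unfolding bounded_iff using cmod_le_norm_transpose[of _ f \<phi>] by blast
  from finite_cover_small_oscillation[of \<Phi> cdual_apply, OF \<Phi>(1) this e4]
  obtain \<C> where \<C>: "finite \<C>" "?D \<subseteq> \<Union>\<C>" and \<C>':
      "\<forall>A\<in>\<C>. A \<subseteq> ?D \<and>
        (\<forall>\<phi>\<in>\<Phi>. \<forall>x\<in>A. \<forall>y\<in>A. dist (cdual_apply \<phi> x) (cdual_apply \<phi> y) < e / 4)"
    by (elim exE conjE)
  have "dist x y \<le> e" if "A \<in> \<C>" "x \<in> A" "y \<in> A" for A x y
    unfolding dist_norm
  proof (rule norm_le_of_functionals)
    fix \<psi>' :: "'b cdual" assume "norm \<psi>' \<le> 1"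
    have *: "cmod (cdual_apply \<psi> (x - y)) \<le> 3 * e / 4" if "norm \<psi> < 1" for \<psi>
    proof -
      have "?T \<psi> \<in> ?T ` ball 0 1" using that by simp
      from G(3)[OF this] obtain \<phi> where \<phi>: "\<phi> \<in> \<Phi>" "dist (?T \<phi>) (?T \<psi>) < e / 4"
        unfolding \<Phi>(2) by blast
      have close: "dist (cdual_apply \<psi> z) (cdual_apply \<phi> z) < e / 4" if "z \<in> ?D" for z
        using cmod_le_norm_transpose[OF that, of "\<phi> - \<psi>"] \<phi>(2)
        by (simp add: dist_norm bounded_clinear_diff_eq[OF bounded_clinear_transpose] norm_minus_commute)
      have "dist (cdual_apply \<phi> x) (cdual_apply \<phi> y) < e / 4"
        using \<C>' \<open>A \<in> \<C>\<close> \<phi>(1) \<open>x \<in> A\<close> \<open>y \<in> A\<close> by blast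
      moreover have "x \<in> ?D" "y \<in> ?D" using \<C>' \<open>A \<in> \<C>\<close> \<open>x \<in> A\<close> \<open>y \<in> A\<close> by auto
      ultimately have "dist (cdual_apply \<psi> x) (cdual_apply \<psi> y) \<le> 3 * e / 4"
        using close[of x] close[of y]
          dist_triangle[of "cdual_apply \<psi> x" "cdual_apply \<psi> y" "cdual_apply \<phi> x"]
          dist_triangle[of "cdual_apply \<phi> x" "cdual_apply \<psi> y" "cdual_apply \<phi> y"]
          dist_commute[of "cdual_apply \<phi> y" "cdual_apply \<psi> y"] by linarith
      then show ?thesis by (simp add: dist_norm cdual_apply_diff)
    qed
    \<comment> \<open>The compactness of the operator concerns the open ball; the factor \<open>3 / 4\<close> moves a
      norming functional, which may have norm one, into it.\<close>
    have "cmod (cdual_apply ((3 / 4) *\<^sub>R \<psi>') (x - y)) \<le> 3 * e / 4"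
      by (rule *) (use \<open>norm \<psi>' \<le> 1\<close> in simp)
    then show "cmod (cdual_apply \<psi>' (x - y)) \<le> e" by simp
  qed
  then show "\<exists>\<C>. finite \<C> \<and> ?D \<subseteq> \<Union>\<C> \<and> (\<forall>A\<in>\<C>. \<forall>x\<in>A. \<forall>y\<in>A. dist x y \<le> e)"
    using \<C>(1,2) by blast
qed

text \<open>
  Composed with the transpose, a continuous functional on the function space becomes a functional
  on the dual that is dominated by the supremum over the relatively compact Lipschitz image.
  So it is an evaluation, and evaluations are weak* continuous.
\<close>

lemma compact_imp_weak_star_weak_continuous:
  fixes f :: "('a::complex_normed_vector, 'b::{complex_normed_vector,banach}) hol_lip"
  assumes "compact_hol_lip f"
  shows "continuous_map weak_star_topology weak_topology (hol_lip_transpose f)"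
  unfolding weak_topology_def continuous_on_generated_topo_iff
proof (intro conjI allI impI)
  let ?T = "hol_lip_transpose f"
  fix V :: "('a, complex) hol_lip set"
  assume "V \<in> {{g. cdual_apply \<psi> g \<in> U} | \<psi> U. open U}"
  then obtain \<psi> U where V: "V = {g. cdual_apply \<psi> g \<in> U}" "open U" by blast
  have "bounded_clinear (\<lambda>\<phi>. cdual_apply \<psi> (?T \<phi>))"
    by (rule bounded_clinear_compose[OF bounded_clinear_cdual_apply bounded_clinear_transpose])
  moreover have "compact (closure (lipschitz_image f))"
    using assms by (simp add: compact_hol_lip_def)
  moreover have "cmod (cdual_apply \<psi> (?T \<phi>)) \<le> norm \<psi> * r"
    if "0 \<le> r" "\<And>d. d \<in> lipschitz_image f \<Longrightarrow> cmod (cdual_apply \<phi> d) \<le> r" for \<phi> r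
  proof -
    have "norm (?T \<phi>) \<le> r" using that by (rule norm_transpose_le)
    then have "norm \<psi> * norm (?T \<phi>) \<le> norm \<psi> * r" by (rule mult_left_mono) simp
    then show ?thesis using cmod_cdual_apply_le[of \<psi> "?T \<phi>"] by linarith
  qed
  ultimately obtain y where y: "\<And>\<phi>. cdual_apply \<psi> (?T \<phi>) = cdual_apply \<phi> y"
    using evaluation_of_compactly_dominated[OF _ _ norm_ge_zero[of \<psi>],
        of "\<lambda>\<phi>. cdual_apply \<psi> (?T \<phi>)" "lipschitz_image f"] by metis
  have "?T -` V \<inter> topspace weak_star_topology = {\<phi>. cdual_apply \<phi> y \<in> U}"
    by (auto simp: V(1) y)
  then show "openin weak_star_topology (?T -` V \<inter> topspace weak_star_topology)"
    using openin_weak_star_evaluation[OF V(2)] by simp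
next
  have "UNIV \<in> {{g::('a, complex) hol_lip. cdual_apply \<psi> g \<in> U} | \<psi> U. open U}"
    by (intro CollectI exI[of _ 0] exI[of _ UNIV]) simp
  then show "hol_lip_transpose f ` topspace weak_star_topology \<subseteq>
      \<Union>{{g. cdual_apply \<psi> g \<in> U} | \<psi> U. open U}" by blast
qed

lemma weak_star_continuous_imp_bounded_weak_star:
  fixes T :: "'b::complex_normed_vector cdual \<Rightarrow> 'c"
  assumes "continuous_map weak_star_topology X T"
  shows "continuous_map bounded_weak_star_topology X T"
proof -
  have "openin bounded_weak_star_topology U" if "openin weak_star_topology U" for U :: "'b cdual set"
    using that by (simp add: openin_bounded_weak_star_topology openin_subtopology_Int)
  then show ?thesis using assms by (simp add: continuous_map_def)
qed

theorem theorem2p8: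
  fixes f :: "('a::{complex_normed_vector,banach}, 'b::{complex_normed_vector,banach}) hol_lip"
  shows "(compact_hol_lip f \<longleftrightarrow>
      compact_operator (hol_lip_transpose f))
    \<and> (compact_hol_lip f \<longleftrightarrow>
      continuous_map bounded_weak_star_topology euclidean (hol_lip_transpose f))
    \<and> (compact_hol_lip f \<longleftrightarrow>
      compact_operator (hol_lip_transpose f) \<and>
      continuous_map bounded_weak_star_topology weak_topology (hol_lip_transpose f))
    \<and> (compact_hol_lip f \<longleftrightarrow>
      compact_operator (hol_lip_transpose f) \<and>
      continuous_map weak_star_topology weak_topology (hol_lip_transpose f))"
proof -
  note compact_imp_bounded_weak_star_continuous[of f]
    bounded_weak_star_continuous_imp_compact_operator[OF bounded_clinear_transpose[of f]]
    compact_transpose_imp_compact[of f] compact_imp_weak_star_weak_continuous[of f]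
    weak_star_continuous_imp_bounded_weak_star[of weak_topology "hol_lip_transpose f"]
  then show ?thesis by blast
qed

end
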